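(* The class of separable Banach spaces with an unconditional basis and not containing an isomorphic copy of $\ell_1$ is strongly bounded: for every analytic set $A\subseteq\mathrm{SB}$ of spaces with an unconditional basis not containing $\ell_1$, there exists a Banach space $Y$ with an unconditional basis, not containing $\ell_1$, that contains isomorphic copies of every $X\in A$.
   Context: Let $C(2^{\mathbb{N}})$ be the Banach space of continuous real functions on the Cantor set with the sup norm. $\mathrm{SB}$ denotes the set of closed linear subspaces of $C(2^{\mathbb{N}})$ with the Effros–Borel $\sigma$-algebra (generated by the sets $\{X: X\cap U\neq\varnothing\}$, $U\subseteq C(2^{\mathbb{N}})$ open), a standard Borel space; a subset of $\mathrm{SB}$ is analytic if it is analytic in this standard Borel space. A class $\mathcal{C}\subseteq\mathrm{SB}$ is called strongly bounded if for every analytic subset $A\subseteq\mathcal{C}$ there exists $Y\in\mathcal{C}$ that contains isomorphic copies of every $X\in A$. *)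

theory Defs
  imports "HOL-Analysis.Analysis"
begin

text \<open>The Cantor set 2^N is the type nat => bool with the product topology
(bool carries its order topology, which is discrete). Since 2^N is compact,
every continuous real function on it is bounded, so the bounded continuous
functions with the sup norm are exactly C(2^N) with the sup norm.\<close>

type_synonym C2N = "(nat \<Rightarrow> bool) \<Rightarrow>\<^sub>C real"

definition SB :: "C2N set set" where
  "SB = {X. subspace X \<and> closed X}"

definition Effros_Borel :: "C2N set measure" where
  "Effros_Borel = sigma SB {{X \<in> SB. X \<inter> U \<noteq> {}} | U. open U}"

definition analytic_SB :: "C2N set set \<Rightarrow> bool" where
  "analytic_SB A \<longleftrightarrow> A = {} \<or>
     (\<exists>f. f \<in> measurable (borel :: (nat \<Rightarrow> nat) measure) Effros_Borel \<and> A = range f)"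

definition linear_on :: "'a::real_vector set \<Rightarrow> ('a \<Rightarrow> 'b::real_vector) \<Rightarrow> bool" where
  "linear_on X T \<longleftrightarrow>
     (\<forall>x\<in>X. \<forall>y\<in>X. \<forall>a b. T (a *\<^sub>R x + b *\<^sub>R y) = a *\<^sub>R T x + b *\<^sub>R T y)"

definition isomorphic_embedding ::
  "'a::real_normed_vector set \<Rightarrow> 'b::real_normed_vector set \<Rightarrow> ('a \<Rightarrow> 'b) \<Rightarrow> bool" where
  "isomorphic_embedding X Y T \<longleftrightarrow>
     (\<forall>x\<in>X. T x \<in> Y) \<and> linear_on X T \<and>
     (\<exists>c>0. \<exists>K. \<forall>x\<in>X. c * norm x \<le> norm (T x) \<and> norm (T x) \<le> K * norm x)"

definition contains_copy :: "'b::real_normed_vector set \<Rightarrow> 'a::real_normed_vector set \<Rightarrow> bool" where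
  "contains_copy Y X \<longleftrightarrow> (\<exists>T. isomorphic_embedding X Y T)"

definition l1 :: "(nat \<Rightarrow> real) set" where
  "l1 = {a. summable (\<lambda>n. \<bar>a n\<bar>)}"

definition l1_norm :: "(nat \<Rightarrow> real) \<Rightarrow> real" where
  "l1_norm a = (\<Sum>n. \<bar>a n\<bar>)"

definition contains_l1 :: "'a::real_normed_vector set \<Rightarrow> bool" where
  "contains_l1 X \<longleftrightarrow>
     (\<exists>T. (\<forall>a\<in>l1. T a \<in> X) \<and>
          (\<forall>a\<in>l1. \<forall>b\<in>l1. \<forall>s t. T (\<lambda>n. s * a n + t * b n) = s *\<^sub>R T a + t *\<^sub>R T b) \<and>
          (\<exists>c>0. \<exists>K. \<forall>a\<in>l1. c * l1_norm a \<le> norm (T a) \<and> norm (T a) \<le> K * l1_norm a))"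

definition schauder_basis :: "'a::real_normed_vector set \<Rightarrow> (nat \<Rightarrow> 'a) \<Rightarrow> bool" where
  "schauder_basis X e \<longleftrightarrow>
     (\<forall>n. e n \<in> X) \<and> (\<forall>x\<in>X. \<exists>!a. (\<lambda>n. a n *\<^sub>R e n) sums x)"

definition unconditional_basis :: "'a::real_normed_vector set \<Rightarrow> (nat \<Rightarrow> 'a) \<Rightarrow> bool" where
  "unconditional_basis X e \<longleftrightarrow>
     schauder_basis X e \<and>
     (\<forall>x\<in>X. \<forall>a. (\<lambda>n. a n *\<^sub>R e n) sums x \<longrightarrow>
        (\<forall>\<pi>. bij \<pi> \<longrightarrow> (\<lambda>n. a (\<pi> n) *\<^sub>R e (\<pi> n)) sums x))"

definition has_unconditional_basis :: "'a::real_normed_vector set \<Rightarrow> bool" where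
  "has_unconditional_basis X \<longleftrightarrow> (\<exists>e. unconditional_basis X e)"

definition UB_no_l1 :: "C2N set set" where
  "UB_no_l1 = {X \<in> SB. has_unconditional_basis X \<and> \<not> contains_l1 X}"

definition strongly_bounded :: "C2N set set \<Rightarrow> bool" where
  "strongly_bounded \<C> \<longleftrightarrow>
     (\<forall>A. A \<subseteq> \<C> \<and> analytic_SB A \<longrightarrow> (\<exists>Y\<in>\<C>. \<forall>X\<in>A. contains_copy Y X))"

end

theory Submission
  imports Defs "HOL-Library.Diagonal_Subsequence"
begin

text \<open>The universal space is the span of functions \<open>E\<^sub>s\<close> on the Cantor set indexed by the
nodes \<open>s\<close> of a countable tree, normed so that
\<open>\<parallel>\<Sum> a\<^sub>s E\<^sub>s\<parallel>\<close> is the supremum of \<open>\<parallel>\<Sum>\<^bsub>s\<in>C\<^esub> a\<^sub>s d\<^sub>s\<parallel>\<close> over all chains \<open>C\<close>, where every branch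
\<open>(d\<^sub>s)\<close> is an unconditional basic sequence close to a sequence in a member of \<open>A\<close>. The tree
exists because an analytic set is a projection of a closed set; it is countable because a basis may be
perturbed into a fixed countable dense set.

That no copy of \<open>\<ell>\<^sub>1\<close> appears needs no interpolation. A point of the Cantor set sees a single
chain, so, as no branch space contains \<open>\<ell>\<^sub>1\<close>, a bounded sequence with coordinates tending to
zero tends to zero at every point (gliding hump). By Simons' lemma some convex combinations of it
are then small in norm, which is impossible for the differences of a subsequence of an \<open>\<ell>\<^sub>1\<close> basis.\<close>

section \<open>Unconditional bases and suppression constants\<close>

text \<open>The obstacle is that the amalgam mixes infinitely many spaces, so a copy of l1 in it
  need not sit on one branch. What localizes it is that a bounded sequence is tested pointwise: an
  infinite chain of nodes determines a branch, and since the tree comes from a closed set this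
  branch again codes a space in A, where l1 is excluded.

  Chains are arbitrary sets of pairwise comparable nodes, not only segments. Every subset of a chain
  therefore counts in the norm, which makes the amalgam 1-suppression unconditional whatever the
  branch sequences are; on a single branch the price is only the suppression constant of that
  branch.

  Unconditionality is carried as a \<open>suppression\<close> constant because this is an inequality
  on finite sums: it survives small perturbations and is a closed condition on codes.

  Bounded and pointwise null means weakly null in C(2^N), and small convex combinations are what
  Mazur's theorem would give; Simons' lemma yields them by elementary means. For differences of l1
  basis vectors they are ruled out by the functional with signs +1 and -1 on the two halves of the
  subsequence.\<close>

definition suppression :: "real \<Rightarrow> (nat \<Rightarrow> 'a::real_normed_vector) \<Rightarrow> bool" where
  "suppression K e \<longleftrightarrow>
     (\<forall>F G a. finite F \<longrightarrow> G \<subseteq> F \<longrightarrow> norm (\<Sum>i\<in>G. a i *\<^sub>R e i) \<le> K * norm (\<Sum>i\<in>F. a i *\<^sub>R e i))"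

lemma suppressionD:
  "suppression K e \<Longrightarrow> finite F \<Longrightarrow> G \<subseteq> F \<Longrightarrow>
     norm (\<Sum>i\<in>G. a i *\<^sub>R e i) \<le> K * norm (\<Sum>i\<in>F. a i *\<^sub>R e i)"
  by (simp add: suppression_def)

lemma suppression_sums_le:
  assumes "suppression K e" "(\<lambda>i. a i *\<^sub>R e i) sums x" "finite G"
  shows "norm (\<Sum>i\<in>G. a i *\<^sub>R e i) \<le> K * norm x"
proof (rule LIMSEQ_le_const)
  show "(\<lambda>N. K * norm (\<Sum>i<N. a i *\<^sub>R e i)) \<longlonglongrightarrow> K * norm x"
    using assms(2) unfolding sums_def by (intro tendsto_intros)
  obtain N where "G \<subseteq> {..<N}"
    using assms(3) finite_nat_iff_bounded by blast
  then have "\<forall>n\<ge>N. norm (\<Sum>i\<in>G. a i *\<^sub>R e i) \<le> K * norm (\<Sum>i<n. a i *\<^sub>R e i)"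
    by (intro allI impI suppressionD[OF assms(1)]) auto
  then show "\<exists>N. \<forall>n\<ge>N. norm (\<Sum>i\<in>G. a i *\<^sub>R e i) \<le> K * norm (\<Sum>i<n. a i *\<^sub>R e i)" ..
qed

lemma suppression_sums_unique:
  assumes "suppression K e" "\<And>i. e i \<noteq> 0"
    and "(\<lambda>i. a i *\<^sub>R e i) sums x" "(\<lambda>i. b i *\<^sub>R e i) sums x"
  shows "a = b"
proof
  fix i
  have "(\<lambda>i. (a i - b i) *\<^sub>R e i) sums 0"
    using sums_diff[OF assms(3,4)] by (simp add: algebra_simps)
  from suppression_sums_le[OF assms(1) this, of "{i}"] show "a i = b i"
    using assms(2)[of i] by (simp add: mult_le_0_iff)
qed

lemma span_range_finite_sum:
  fixes e :: "nat \<Rightarrow> 'a::real_vector"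
  assumes "x \<in> span (range e)"
  obtains F a where "finite F" "x = (\<Sum>i\<in>F. a i *\<^sub>R e i)" "\<And>i. i \<notin> F \<Longrightarrow> a i = 0"
proof -
  have "\<exists>F a. finite F \<and> x = (\<Sum>i\<in>F. a i *\<^sub>R e i) \<and> (\<forall>i. i \<notin> F \<longrightarrow> a i = 0)"
    using assms
  proof (induction rule: span_induct_alt)
    case base
    show ?case by (rule exI[of _ "{}"], rule exI[of _ "\<lambda>_. 0"]) simp
  next
    case (step c x y)
    then obtain F a where F: "finite F" "y = (\<Sum>i\<in>F. a i *\<^sub>R e i)" "\<forall>i. i \<notin> F \<longrightarrow> a i = 0"
      by blast
    obtain k where k: "x = e k" using step by blast
    let ?a = "a(k := a k + c)"
    have y: "y = (\<Sum>i\<in>insert k F. a i *\<^sub>R e i)"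
      unfolding F(2) by (rule sum.mono_neutral_left) (use F in auto)
    have "(\<Sum>i\<in>insert k F. ?a i *\<^sub>R e i) =
        (\<Sum>i\<in>insert k F. a i *\<^sub>R e i + (if i = k then c *\<^sub>R e k else 0))"
      by (rule sum.cong) (auto simp: algebra_simps)
    also have "\<dots> = c *\<^sub>R x + y"
      using F(1) by (simp add: y k sum.distrib add.commute)
    finally show ?case
      using F by (intro exI[of _ "insert k F"] exI[of _ ?a]) auto
  qed
  then show ?thesis using that by blast
qed

text \<open>Suppression to single indices makes the coefficients of approximating finite sums
  Cauchy; suppression to arbitrary finite sets then carries the approximation over to the limit
  coefficients, uniformly in the set. The expansion is an unordered sum, so invariance under
  permutations comes for free.\<close>

lemma suppression_expansion:
  fixes e :: "nat \<Rightarrow> 'a::banach"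
  assumes K: "suppression K e" and nz: "\<And>i. e i \<noteq> 0"
    and x: "x \<in> closure (span (range e))"
  obtains a where "((\<lambda>i. a i *\<^sub>R e i) has_sum x) UNIV"
proof -
  obtain X where X: "\<And>k. X k \<in> span (range e)" "X \<longlonglongrightarrow> x"
    using x closure_sequential by metis
  have "\<exists>F a. finite F \<and> X k = (\<Sum>i\<in>F. a i *\<^sub>R e i) \<and> (\<forall>i. i \<notin> F \<longrightarrow> a i = 0)" for k
    using span_range_finite_sum[OF X(1)] by metis
  then obtain F a where F: "\<And>k. finite (F k)" "\<And>k. X k = (\<Sum>i\<in>F k. a k i *\<^sub>R e i)"
     "\<And>k i. i \<notin> F k \<Longrightarrow> a k i = 0"
    by metis
  \<comment> \<open>Coefficients vanish off \<open>F k\<close>, so any two of the \<open>X k\<close>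
    can be written over one common index set.\<close>
  have Xs: "X k = (\<Sum>i\<in>H. a k i *\<^sub>R e i)" if "finite H" "F k \<subseteq> H" for k H
    unfolding F(2) by (rule sum.mono_neutral_left) (use F that in auto)
  have diff: "norm (\<Sum>i\<in>G. (a k i - a l i) *\<^sub>R e i) \<le> K * norm (X k - X l)"
    if "finite G" for k l G
  proof -
    let ?H = "G \<union> F k \<union> F l"
    have "finite ?H" using that F by auto
    have "X k - X l = (\<Sum>i\<in>?H. (a k i - a l i) *\<^sub>R e i)"
      using Xs[of ?H k] Xs[of ?H l] \<open>finite ?H\<close>
      by (auto simp: sum_subtractf scaleR_left_diff_distrib)
    then show ?thesis
      using suppressionD[OF K \<open>finite ?H\<close>, of G "\<lambda>i. a k i - a l i"] by auto
  qed
  have K0: "0 \<le> K"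
    using suppressionD[OF K, of "{0}" "{0}" "\<lambda>_. 1"] nz[of 0]
    by (simp add: mult_le_cancel_right1)
  have XC: "Cauchy X" using X(2) LIMSEQ_imp_Cauchy by blast
  have "Cauchy (\<lambda>k. a k i)" for i
  proof (rule metric_CauchyI)
    fix \<epsilon> :: real assume "\<epsilon> > 0"
    define \<delta> where "\<delta> = \<epsilon> * norm (e i) / (K + 1)"
    have "\<delta> > 0" using \<open>\<epsilon> > 0\<close> nz[of i] K0 by (simp add: \<delta>_def)
    then obtain M where M: "\<forall>m\<ge>M. \<forall>n\<ge>M. norm (X m - X n) < \<delta>"
      using XC Cauchy_iff by blast
    have "dist (a m i) (a n i) < \<epsilon>" if "m \<ge> M" "n \<ge> M" for m n
    proof -
      have "\<bar>a m i - a n i\<bar> * norm (e i) \<le> K * norm (X m - X n)"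
        using diff[of "{i}" m n] by simp
      also have "\<dots> \<le> K * \<delta>" using M that K0 by (intro mult_left_mono) (auto simp: less_imp_le)
      also have "\<dots> < (K + 1) * \<delta>" using \<open>\<delta> > 0\<close> by simp
      also have "\<dots> = \<epsilon> * norm (e i)" using K0 by (simp add: \<delta>_def)
      finally show ?thesis using nz[of i] by (simp add: dist_real_def)
    qed
    then show "\<exists>M. \<forall>m\<ge>M. \<forall>n\<ge>M. dist (a m i) (a n i) < \<epsilon>" by blast
  qed
  then have "\<exists>l. (\<lambda>k. a k i) \<longlonglongrightarrow> l" for i
    by (simp add: Cauchy_convergent_iff convergent_def)
  then obtain b where b: "\<And>i. (\<lambda>k. a k i) \<longlonglongrightarrow> b i" by metis
  have "((\<lambda>i. b i *\<^sub>R e i) has_sum x) UNIV"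
    unfolding has_sum_def tendsto_iff eventually_finite_subsets_at_top
  proof (intro allI impI)
    fix \<epsilon> :: real assume "\<epsilon> > 0"
    define \<delta> where "\<delta> = \<epsilon> / (K + 2)"
    have "\<delta> > 0" using \<open>\<epsilon> > 0\<close> K0 by (simp add: \<delta>_def)
    have "\<forall>\<^sub>F k in sequentially. dist (X k) x < \<delta>" "\<exists>M. \<forall>m\<ge>M. \<forall>n\<ge>M. norm (X m - X n) < \<delta>"
      using X(2) XC \<open>\<delta> > 0\<close> by (auto simp: tendsto_iff Cauchy_iff)
    then obtain M k where M: "\<forall>m\<ge>M. \<forall>n\<ge>M. norm (X m - X n) < \<delta>"
      and k: "k \<ge> M" "dist (X k) x < \<delta>"
      unfolding eventually_sequentially by (metis nat_le_linear)
    have "dist (\<Sum>i\<in>H. b i *\<^sub>R e i) x < \<epsilon>" if H: "finite H" "F k \<subseteq> H" for H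
    proof -
      have "norm (\<Sum>i\<in>H. (a k i - b i) *\<^sub>R e i) \<le> K * \<delta>"
      proof (rule LIMSEQ_le_const2)
        show "(\<lambda>l. norm (\<Sum>i\<in>H. (a k i - a l i) *\<^sub>R e i)) \<longlonglongrightarrow> norm (\<Sum>i\<in>H. (a k i - b i) *\<^sub>R e i)"
          by (intro tendsto_intros b)
        have "norm (\<Sum>i\<in>H. (a k i - a n i) *\<^sub>R e i) \<le> K * \<delta>" if "n \<ge> M" for n
          using diff[OF H(1), of k n] M that k(1) K0
          by (meson less_imp_le mult_left_mono order_trans)
        then show "\<exists>N. \<forall>n\<ge>N. norm (\<Sum>i\<in>H. (a k i - a n i) *\<^sub>R e i) \<le> K * \<delta>" by blast
      qed
      moreover have "(\<Sum>i\<in>H. (a k i - b i) *\<^sub>R e i) = X k - (\<Sum>i\<in>H. b i *\<^sub>R e i)"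
        using Xs[OF H] by (simp add: sum_subtractf scaleR_left_diff_distrib)
      ultimately have "dist (\<Sum>i\<in>H. b i *\<^sub>R e i) (X k) \<le> K * \<delta>"
        by (simp add: dist_norm norm_minus_commute)
      then have "dist (\<Sum>i\<in>H. b i *\<^sub>R e i) x < K * \<delta> + \<delta>"
        using k(2) dist_triangle[of "\<Sum>i\<in>H. b i *\<^sub>R e i" x "X k"] by linarith
      also have "\<dots> \<le> (K + 2) * \<delta>" using \<open>\<delta> > 0\<close> by (simp add: algebra_simps)
      also have "\<dots> = \<epsilon>" using K0 by (simp add: \<delta>_def)
      finally show ?thesis .
    qed
    then show "\<exists>X. finite X \<and> X \<subseteq> UNIV \<and>
        (\<forall>Y. finite Y \<and> X \<subseteq> Y \<and> Y \<subseteq> UNIV \<longrightarrow> dist (\<Sum>i\<in>Y. b i *\<^sub>R e i) x < \<epsilon>)"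
      using F(1) by (intro exI[of _ "F k"]) auto
  qed
  then show ?thesis using that by blast
qed

lemma sums_in_closure_span:
  fixes e :: "nat \<Rightarrow> 'a::real_normed_vector"
  assumes "(\<lambda>i. a i *\<^sub>R e i) sums x"
  shows "x \<in> closure (span (range e))"
  unfolding closure_sequential
  using assms unfolding sums_def
  by (intro exI[of _ "\<lambda>n. \<Sum>i<n. a i *\<^sub>R e i"] conjI allI span_sum span_scale)
     (auto intro: span_base)

lemma subspace_closure_real:
  fixes S :: "'a::real_normed_vector set"
  assumes "subspace S"
  shows "subspace (closure S)"
proof (rule subspaceI)
  show "0 \<in> closure S" using subspace_0[OF assms] closure_subset by blast
next
  fix x y assume "x \<in> closure S" "y \<in> closure S"
  then obtain f g where "\<And>n. f n \<in> S" "f \<longlonglongrightarrow> x" "\<And>n. g n \<in> S" "g \<longlonglongrightarrow> y"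
    by (metis closure_sequential)
  then show "x + y \<in> closure S"
    unfolding closure_sequential using subspace_add[OF assms]
    by (intro exI[of _ "\<lambda>n. f n + g n"]) (auto intro: tendsto_add)
next
  fix c :: real and x assume "x \<in> closure S"
  then obtain f where "\<And>n. f n \<in> S" "f \<longlonglongrightarrow> x"
    by (metis closure_sequential)
  then show "c *\<^sub>R x \<in> closure S"
    unfolding closure_sequential using subspace_scale[OF assms]
    by (intro exI[of _ "\<lambda>n. c *\<^sub>R f n"]) (auto intro: tendsto_scaleR)
qed

lemma suppression_unconditional_basis:
  fixes e :: "nat \<Rightarrow> 'a::banach"
  assumes K: "suppression K e" and nz: "\<And>i. e i \<noteq> 0"
  shows "unconditional_basis (closure (span (range e))) e"
  unfolding unconditional_basis_def schauder_basis_def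
proof (intro conjI ballI allI impI)
  show "e n \<in> closure (span (range e))" for n
    by (meson closure_subset rangeI span_base subsetD)
next
  fix x assume "x \<in> closure (span (range e))"
  then obtain a where "((\<lambda>i. a i *\<^sub>R e i) has_sum x) UNIV"
    using suppression_expansion[OF K nz] by blast
  then have "(\<lambda>i. a i *\<^sub>R e i) sums x" by (rule has_sum_imp_sums)
  then show "\<exists>!a. (\<lambda>n. a n *\<^sub>R e n) sums x"
    using suppression_sums_unique[OF K nz] by blast
next
  fix x a \<pi>
  assume x: "x \<in> closure (span (range e))" and a: "(\<lambda>n. a n *\<^sub>R e n) sums x"
    and \<pi>: "bij (\<pi> :: nat \<Rightarrow> nat)"
  obtain b where b: "((\<lambda>i. b i *\<^sub>R e i) has_sum x) UNIV"
    using suppression_expansion[OF K nz x] by blast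
  then have "a = b"
    using suppression_sums_unique[OF K nz a] has_sum_imp_sums by blast
  with b \<pi> have "((\<lambda>n. a (\<pi> n) *\<^sub>R e (\<pi> n)) has_sum x) UNIV"
    using has_sum_reindex_bij_betw[of \<pi> UNIV UNIV "\<lambda>i. a i *\<^sub>R e i"] by simp
  then show "(\<lambda>n. a (\<pi> n) *\<^sub>R e (\<pi> n)) sums x" by (rule has_sum_imp_sums)
qed

text \<open>Meaningful on the closed span of a suppression sequence of nonzero vectors, where
  expansions exist and are unique.\<close>

definition coords :: "(nat \<Rightarrow> 'a::real_normed_vector) \<Rightarrow> 'a \<Rightarrow> nat \<Rightarrow> real" where
  "coords e x = (THE a. (\<lambda>n. a n *\<^sub>R e n) sums x)"

lemma coords_eq:
  assumes "suppression K e" "\<And>i. e i \<noteq> 0" "(\<lambda>n. a n *\<^sub>R e n) sums x"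
  shows "coords e x = a"
  unfolding coords_def
  by (rule the_equality[where P = "\<lambda>a. (\<lambda>n. a n *\<^sub>R e n) sums x", OF assms(3)])
     (rule suppression_sums_unique[OF assms(1,2) _ assms(3)])

lemma coords_sums:
  fixes e :: "nat \<Rightarrow> 'a::banach"
  assumes "suppression K e" "\<And>i. e i \<noteq> 0" "x \<in> closure (span (range e))"
  shows "(\<lambda>n. coords e x n *\<^sub>R e n) sums x"
proof -
  obtain a where "(\<lambda>i. a i *\<^sub>R e i) sums x"
    using suppression_expansion[OF assms] has_sum_imp_sums by blast
  then show ?thesis using coords_eq[OF assms(1,2)] by blast
qed

lemma coords_linear:
  fixes e :: "nat \<Rightarrow> 'a::banach"
  assumes "suppression K e" "\<And>i. e i \<noteq> 0"
    and "x \<in> closure (span (range e))" "y \<in> closure (span (range e))"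
  shows "coords e (s *\<^sub>R x + t *\<^sub>R y) n = s * coords e x n + t * coords e y n"
proof -
  have "(\<lambda>n. (s * coords e x n + t * coords e y n) *\<^sub>R e n) sums (s *\<^sub>R x + t *\<^sub>R y)"
    using sums_add[OF sums_scaleR_right[OF coords_sums[OF assms(1-3)]]
        sums_scaleR_right[OF coords_sums[OF assms(1,2,4)]]]
    by (simp add: scaleR_left_distrib)
  from coords_eq[OF assms(1,2) this] show ?thesis by simp
qed

text \<open>If the finite sums were unbounded, there would be successive finite sets with sums of norm at
least 1; a permutation that lists each of them contiguously gives a divergent series.\<close>

lemma permutation_bounded_sums:
  fixes f :: "nat \<Rightarrow> 'a::real_normed_vector"
  assumes "\<And>\<pi>. bij \<pi> \<Longrightarrow> summable (\<lambda>n. f (\<pi> n))"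
  shows "\<exists>B. \<forall>F. finite F \<longrightarrow> norm (sum f F) \<le> B"
proof (rule ccontr)
  assume "\<not> ?thesis"
  then have unb: "\<exists>F. finite F \<and> norm (sum f F) > B" for B by (metis linorder_not_le)
  \<comment> \<open>Dropping the indices below N costs at most the sum of the norms of those terms,
    so a sum exceeding 1 plus that amount keeps norm at least 1 on the tail.\<close>
  have "\<exists>F. finite F \<and> F \<subseteq> {N..} \<and> norm (sum f F) \<ge> 1" for N
  proof -
    obtain F where F: "finite F" "norm (sum f F) > 1 + (\<Sum>i<N. norm (f i))"
      using unb by blast
    have "sum f F = sum f (F \<inter> {..<N}) + sum f (F - {..<N})"
      using F(1) by (metis sum.Int_Diff)
    moreover have "norm (sum f (F \<inter> {..<N})) \<le> (\<Sum>i<N. norm (f i))"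
      by (rule order_trans[OF norm_sum]) (rule sum_mono2, auto)
    ultimately have "norm (sum f (F - {..<N})) \<ge> 1"
      using F(2) norm_triangle_ineq[of "sum f (F \<inter> {..<N})" "sum f (F - {..<N})"] by simp
    then show ?thesis using F(1) by (intro exI[of _ "F - {..<N}"]) auto
  qed
  then obtain G where G: "\<And>N. finite (G N)" "\<And>N. G N \<subseteq> {N..}" "\<And>N. norm (sum f (G N)) \<ge> 1"
    by metis
  \<comment> \<open>The interval from \<open>N j\<close> to \<open>N (Suc j)\<close> is to contain
    \<open>G (N j)\<close>; inserting m itself forces strict growth.\<close>
  define N where "N = rec_nat 0 (\<lambda>_ m. Suc (Max (insert m (G m))))"
  have N0: "N 0 = 0" and NS: "N (Suc j) = Suc (Max (insert (N j) (G (N j))))" for j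
    by (auto simp: N_def)
  have Nlt: "N j < N (Suc j)" for j
    unfolding NS using G(1) by (metis Max_ge finite_insert insertI1 le_imp_less_Suc)
  have mono: "strict_mono N" using Nlt by (simp add: strict_mono_Suc_iff)
  have GN: "G (N j) \<subseteq> {N j..<N (Suc j)}" for j
  proof
    fix i assume "i \<in> G (N j)"
    moreover from this have "i < N (Suc j)"
      unfolding NS using G(1) by (metis Max_ge finite_insert insertI2 le_imp_less_Suc)
    ultimately show "i \<in> {N j..<N (Suc j)}" using G(2)[of "N j"] by auto
  qed
  \<comment> \<open>Each interval is permuted so that \<open>G (N j)\<close> is listed first; the
    complements have equal cardinality, so the rest can be matched.\<close>
  have "\<exists>\<beta>. bij_betw \<beta> {N j..<N (Suc j)} {N j..<N (Suc j)} \<and>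
            bij_betw \<beta> {N j..<N j + card (G (N j))} (G (N j))" for j
  proof -
    let ?A = "{N j..<N (Suc j)}" and ?B = "{N j..<N j + card (G (N j))}"
    have cG: "card (G (N j)) \<le> N (Suc j) - N j"
      using card_mono[OF _ GN[of j]] by simp
    then have "?B \<subseteq> ?A" using Nlt[of j] by auto
    obtain h where h: "bij_betw h ?B (G (N j))"
      using G(1) by (metis card_atLeastLessThan diff_add_inverse finite_atLeastLessThan
          finite_same_card_bij)
    have "card (?A - ?B) = card (?A - G (N j))"
      using card_Diff_subset[of ?B ?A] card_Diff_subset[OF G(1) GN] \<open>?B \<subseteq> ?A\<close> by simp
    then obtain h' where h': "bij_betw h' (?A - ?B) (?A - G (N j))"
      using finite_same_card_bij[of "?A - ?B" "?A - G (N j)"] by blast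
    let ?\<beta> = "\<lambda>i. if i \<in> ?B then h i else h' i"
    have "bij_betw ?\<beta> (?B \<union> (?A - ?B)) (G (N j) \<union> (?A - G (N j)))"
      using bij_betw_disjoint_Un[OF h h'] by auto
    moreover have "?B \<union> (?A - ?B) = ?A" "G (N j) \<union> (?A - G (N j)) = ?A"
      using \<open>?B \<subseteq> ?A\<close> GN[of j] by auto
    moreover have "bij_betw ?\<beta> ?B (G (N j))"
      using h by (rule bij_betw_cong[THEN iffD1, rotated]) auto
    ultimately show ?thesis by metis
  qed
  then obtain \<beta> where \<beta>: "\<And>j. bij_betw (\<beta> j) {N j..<N (Suc j)} {N j..<N (Suc j)}"
     "\<And>j. bij_betw (\<beta> j) {N j..<N j + card (G (N j))} (G (N j))" by metis
  define J where "J n = (LEAST j. n < N (Suc j))" for n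
  define \<pi> where "\<pi> n = \<beta> (J n) n" for n
  have J: "J n = j" if "n \<in> {N j..<N (Suc j)}" for n j
    unfolding J_def
  proof (rule Least_equality)
    show "n < N (Suc j)" using that by simp
    fix i assume "n < N (Suc i)"
    then have "N j < N (Suc i)" using that by simp
    then have "j < Suc i" using mono by (simp add: strict_mono_less)
    then show "j \<le> i" by simp
  qed
  have \<pi>\<beta>: "\<pi> n = \<beta> j n" if "n \<in> {N j..<N (Suc j)}" for n j
    using J[OF that] by (simp add: \<pi>_def)
  have cover: "(\<Union>j. {N j..<N (Suc j)}) = UNIV"
  proof (rule UNIV_eq_I[symmetric])
    fix n
    have "n < N (Suc n)" using seq_suble[OF mono, of "Suc n"] by simp
    then have "\<exists>j. n < N (Suc j)" ..
    then have "n < N (Suc (J n))" unfolding J_def by (rule LeastI_ex)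
    moreover have "N (J n) \<le> n"
    proof (cases "J n")
      case (Suc i)
      then have "\<not> n < N (Suc i)" unfolding J_def using not_less_Least[of i "\<lambda>j. n < N (Suc j)"] by simp
      then show ?thesis using Suc by simp
    qed (simp add: N0)
    ultimately show "n \<in> (\<Union>j. {N j..<N (Suc j)})" by auto
  qed
  have "bij_betw \<pi> (\<Union>j. {N j..<N (Suc j)}) (\<Union>j. {N j..<N (Suc j)})"
  proof (rule bij_betw_UNION_disjoint)
    show "disjoint_family_on (\<lambda>j. {N j..<N (Suc j)}) UNIV"
      unfolding disjoint_family_on_def by (metis J disjoint_iff)
    show "bij_betw \<pi> {N j..<N (Suc j)} {N j..<N (Suc j)}" for j
      using \<beta>(1)[of j] by (rule bij_betw_cong[THEN iffD1, rotated]) (simp add: \<pi>\<beta>)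
  qed
  then have "bij \<pi>" using cover by simp
  then have "summable (\<lambda>n. f (\<pi> n))" by (rule assms)
  then have "Cauchy (\<lambda>n. \<Sum>i<n. f (\<pi> i))"
    by (simp add: summable_iff_convergent convergent_Cauchy)
  then obtain M where M: "\<forall>m\<ge>M. \<forall>n\<ge>M. norm ((\<Sum>i<m. f (\<pi> i)) - (\<Sum>i<n. f (\<pi> i))) < 1"
    unfolding Cauchy_iff using zero_less_one by blast
  have "N M \<ge> M" using mono by (rule strict_mono_imp_increasing)
  \<comment> \<open>The terms from \<open>?p\<close> to \<open>?q\<close> are those of
    \<open>G (N M)\<close>, so two partial sums beyond M differ by at least 1 in norm.\<close>
  let ?p = "N M" and ?q = "N M + card (G (N M))"
  have "(\<Sum>i<?q. f (\<pi> i)) = (\<Sum>i<?p. f (\<pi> i)) + (\<Sum>i\<in>{?p..<?q}. f (\<pi> i))"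
    by (subst sum.union_disjoint[symmetric]) (auto intro!: sum.cong)
  moreover have "(\<Sum>i\<in>{?p..<?q}. f (\<pi> i)) = sum f (G (N M))"
  proof -
    have "card (G (N M)) \<le> N (Suc M) - N M"
      using card_mono[OF _ GN[of M]] by simp
    then have "(\<Sum>i\<in>{?p..<?q}. f (\<pi> i)) = (\<Sum>i\<in>{?p..<?q}. f (\<beta> M i))"
      using Nlt[of M] by (intro sum.cong refl arg_cong[where f = f] \<pi>\<beta>) auto
    also have "\<dots> = sum f (G (N M))"
      using sum.reindex_bij_betw[OF \<beta>(2)] by blast
    finally show ?thesis .
  qed
  ultimately have "norm (sum f (G (N M))) < 1"
    using M[rule_format, of ?q ?p] \<open>N M \<ge> M\<close> by simp
  then show False using G(3)[of "N M"] by simp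
qed

text \<open>The coordinate functionals are not known to be continuous, so uniform boundedness does not
apply directly: Baire's theorem makes the closure of some \<open>A m\<close> a neighbourhood, and successive
approximation removes the closure, as in the open mapping theorem.\<close>

lemma unconditional_basis_suppression:
  fixes X :: "'a::banach set"
  assumes sub: "subspace X" and cl: "closed X" and ub: "unconditional_basis X e"
  obtains K where "suppression K e" "\<And>n. e n \<noteq> 0"
proof -
  have eX: "e n \<in> X" and ex1: "x \<in> X \<Longrightarrow> \<exists>!a. (\<lambda>n. a n *\<^sub>R e n) sums x" for n x
    using ub by (auto simp: unconditional_basis_def schauder_basis_def)
  have perm: "(\<lambda>n. a (\<pi> n) *\<^sub>R e (\<pi> n)) sums x"
    if "x \<in> X" "(\<lambda>n. a n *\<^sub>R e n) sums x" "bij \<pi>" for x a \<pi>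
    using ub that by (auto simp: unconditional_basis_def)
  have "\<forall>x\<in>X. \<exists>a. (\<lambda>n. a n *\<^sub>R e n) sums x"
    using ex1 by blast
  then obtain co where co: "\<And>x. x \<in> X \<Longrightarrow> (\<lambda>n. co x n *\<^sub>R e n) sums x"
    by metis
  have uniq: "a = co x" if "x \<in> X" "(\<lambda>n. a n *\<^sub>R e n) sums x" for x a
    using ex1[OF that(1)] that co by blast
  have nz: "e n \<noteq> 0" for n
  proof
    assume "e n = 0"
    then have "(\<lambda>i. (if i = n then 1 else 0) *\<^sub>R e i) = (\<lambda>i. 0)"
      by auto
    then have "(\<lambda>i. if i = n then 1 else 0) = co 0"
      by (intro uniq subspace_0[OF sub]) simp
    moreover have "(\<lambda>i. 0) = co 0"
      by (intro uniq subspace_0[OF sub]) simp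
    ultimately have "(\<lambda>i. if i = n then 1 else 0 :: real) = (\<lambda>i. 0)"
      by (rule trans[OF _ sym])
    from fun_cong[OF this, of n] show False by simp
  qed
  have lin: "co (s *\<^sub>R x + t *\<^sub>R y) n = s * co x n + t * co y n" if "x \<in> X" "y \<in> X" for s t x y n
  proof -
    have "(\<lambda>n. (s * co x n + t * co y n) *\<^sub>R e n) sums (s *\<^sub>R x + t *\<^sub>R y)"
      using sums_add[OF sums_scaleR_right[OF co[OF that(1)]] sums_scaleR_right[OF co[OF that(2)]]]
      by (simp add: scaleR_left_distrib)
    moreover have "s *\<^sub>R x + t *\<^sub>R y \<in> X"
      by (intro subspace_add[OF sub] subspace_scale[OF sub] that)
    ultimately have "(\<lambda>n. s * co x n + t * co y n) = co (s *\<^sub>R x + t *\<^sub>R y)"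
      by (rule uniq[rotated])
    from fun_cong[OF this, of n] show ?thesis by simp
  qed
  \<comment> \<open>\<open>nb x m\<close> bounds x by m in the norm given by the supremum over all
    finite partial sums; what must be shown is that this norm is dominated by the original
    one.\<close>
  define nb where "nb x m \<longleftrightarrow> (\<forall>F. finite F \<longrightarrow> norm (\<Sum>i\<in>F. co x i *\<^sub>R e i) \<le> m)" for x m
  have nbD: "norm (\<Sum>i\<in>F. co x i *\<^sub>R e i) \<le> m" if "nb x m" "finite F" for x m F
    using that by (auto simp: nb_def)
  have nb_lin: "nb (s *\<^sub>R x + t *\<^sub>R y) (\<bar>s\<bar> * m + \<bar>t\<bar> * m')"
    if "x \<in> X" "y \<in> X" "nb x m" "nb y m'" for s t x y m m'
    unfolding nb_def
  proof (intro allI impI)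
    fix F :: "nat set" assume F: "finite F"
    have "(\<Sum>i\<in>F. co (s *\<^sub>R x + t *\<^sub>R y) i *\<^sub>R e i) =
       s *\<^sub>R (\<Sum>i\<in>F. co x i *\<^sub>R e i) + t *\<^sub>R (\<Sum>i\<in>F. co y i *\<^sub>R e i)"
      by (simp add: lin that scaleR_left_distrib sum.distrib scaleR_sum_right)
    also have "norm \<dots> \<le> \<bar>s\<bar> * norm (\<Sum>i\<in>F. co x i *\<^sub>R e i) + \<bar>t\<bar> * norm (\<Sum>i\<in>F. co y i *\<^sub>R e i)"
      using norm_triangle_ineq[of "s *\<^sub>R (\<Sum>i\<in>F. co x i *\<^sub>R e i)" "t *\<^sub>R (\<Sum>i\<in>F. co y i *\<^sub>R e i)"]
      by simp
    also have "\<dots> \<le> \<bar>s\<bar> * m + \<bar>t\<bar> * m'"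
      using nbD[OF that(3) F] nbD[OF that(4) F] by (intro add_mono mult_left_mono) auto
    finally show "norm (\<Sum>i\<in>F. co (s *\<^sub>R x + t *\<^sub>R y) i *\<^sub>R e i) \<le> \<bar>s\<bar> * m + \<bar>t\<bar> * m'" .
  qed
  have nb_norm: "norm x \<le> m" if "x \<in> X" "nb x m" for x m
  proof (rule LIMSEQ_le_const2)
    show "(\<lambda>n. norm (\<Sum>i<n. co x i *\<^sub>R e i)) \<longlonglongrightarrow> norm x"
      using co[OF that(1)] unfolding sums_def by (rule tendsto_norm)
    show "\<exists>N. \<forall>n\<ge>N. norm (\<Sum>i<n. co x i *\<^sub>R e i) \<le> m"
      using nbD[OF that(2)] by simp
  qed
  have ex_nb: "\<exists>m. nb x (real m)" if "x \<in> X" for x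
  proof -
    have "\<exists>B. \<forall>F. finite F \<longrightarrow> norm (sum (\<lambda>i. co x i *\<^sub>R e i) F) \<le> B"
      by (rule permutation_bounded_sums) (use perm[OF that co[OF that]] in \<open>auto simp: sums_iff\<close>)
    then obtain B where B: "\<forall>F. finite F \<longrightarrow> norm (\<Sum>i\<in>F. co x i *\<^sub>R e i) \<le> B" by blast
    obtain m where "B \<le> real m" using real_arch_simple by blast
    then show ?thesis using B unfolding nb_def by (meson order_trans)
  qed
  define A where "A m = {x \<in> X. nb x (real m)}" for m
  have AX: "closure (A m) \<subseteq> X" for m
    using cl by (simp add: A_def closure_minimal)
  have "\<exists>m. top_of_set X interior_of closure (A m) \<noteq> {}"
  proof (rule ccontr)
    assume "\<not> ?thesis"
    then have "top_of_set X interior_of \<Union> (range (\<lambda>m. closure (A m))) = {}"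
      using cl AX
      by (intro Baire_category_alt disjI1 completely_metrizable_space_closedin[OF completely_metrizable_space_euclidean])
         (auto simp: closed_subset)
    moreover have "\<Union> (range (\<lambda>m. closure (A m))) = X"
      using AX ex_nb closure_subset unfolding A_def by fastforce
    ultimately show False
      using subspace_0[OF sub] by (metis empty_iff interior_of_topspace topspace_euclidean_subtopology)
  qed
  then obtain m x0 where "x0 \<in> top_of_set X interior_of closure (A m)" by blast
  then obtain T where T: "openin (top_of_set X) T" "T \<subseteq> closure (A m)" "x0 \<in> T"
    by (auto simp: interior_of_def)
  then have x0X: "x0 \<in> X" using openin_subset[OF T(1)] by auto
  obtain r where r: "r > 0" "\<And>y. y \<in> X \<Longrightarrow> dist y x0 < r \<Longrightarrow> y \<in> closure (A m)"
    using T by (metis openin_euclidean_subtopology_iff subset_eq)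
  \<comment> \<open>Writing y as half of (x0 + y) - (x0 - y) moves the ball around x0 to the origin,
    \<open>nb\<close> being convex and symmetric.\<close>
  have approx1: "\<exists>u\<in>X. nb u (real m) \<and> norm (y - u) < \<delta>"
    if "y \<in> X" "norm y < r" "\<delta> > 0" for y \<delta>
  proof -
    have "x0 + y \<in> closure (A m)" "x0 - y \<in> closure (A m)"
      using that x0X sub by (auto intro!: r(2) subspace_add subspace_diff simp: dist_norm)
    then obtain u v where u: "u \<in> A m" "dist u (x0 + y) < \<delta>" and v: "v \<in> A m" "dist v (x0 - y) < \<delta>"
      using \<open>\<delta> > 0\<close> by (meson closure_approachable)
    let ?w = "(1/2) *\<^sub>R u + (-1/2) *\<^sub>R v"
    have "?w \<in> X" using u v sub
      by (auto simp: A_def intro!: subspace_add subspace_diff subspace_scale)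
    moreover have "nb ?w (real m)"
      using nb_lin[of u v "real m" "real m" "1/2" "-1/2"] u v by (simp add: A_def)
    moreover have "y - ?w = (1/2) *\<^sub>R ((x0 + y) - u) - (1/2) *\<^sub>R ((x0 - y) - v)"
      by (simp add: algebra_simps flip: scaleR_left_distrib)
    then have "norm (y - ?w) \<le> (1/2) * norm ((x0 + y) - u) + (1/2) * norm ((x0 - y) - v)"
      by (metis (no_types, opaque_lifting) abs_divide abs_numeral abs_one norm_scaleR norm_triangle_ineq4)
    then have "norm (y - ?w) < \<delta>"
      using u(2) v(2) by (simp add: dist_norm norm_minus_commute)
    ultimately show ?thesis by blast
  qed
  have approx: "\<exists>u\<in>X. nb u (real m / 2^k) \<and> norm (y - u) < r / 2^(Suc k)"
    if "y \<in> X" "norm y < r / 2^k" for y k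
  proof -
    have "2^k *\<^sub>R y \<in> X" "norm (2^k *\<^sub>R y) < r"
      using that sub by (auto simp: subspace_scale field_simps)
    then obtain u where u: "u \<in> X" "nb u (real m)" "norm (2^k *\<^sub>R y - u) < r / 2"
      using approx1[of "2^k *\<^sub>R y" "r/2"] r(1) by auto
    let ?u = "(1/2^k) *\<^sub>R u"
    have "?u \<in> X" using u sub by (simp add: subspace_scale)
    moreover have "nb ?u (real m / 2^k)"
      using nb_lin[OF u(1) u(1) u(2) u(2), of "1/2^k" 0] by simp
    moreover have "y - ?u = (1/2^k) *\<^sub>R (2^k *\<^sub>R y - u)" by (simp add: algebra_simps)
    then have "norm (y - ?u) = (1/2^k) * norm (2^k *\<^sub>R y - u)"
      by (metis abs_divide abs_numeral abs_one norm_scaleR power_abs)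
    then have "norm (y - ?u) < r / 2^(Suc k)"
      using u(3) by (simp add: field_simps)
    ultimately show ?thesis by blast
  qed
  \<comment> \<open>The remainder is approximated again, each time at half the scale; the
    corrections have bounds \<open>real m / 2^k\<close>, which add up to
    \<open>2 * real m\<close>.\<close>
  have main: "nb x (2 * real m)" if xX: "x \<in> X" and xr: "norm x < r" for x
  proof -
    have "\<exists>U. \<forall>k. (U k \<in> X \<and> norm (x - U k) < r / 2^k) \<and>
        (\<exists>u\<in>X. nb u (real m / 2^k) \<and> U (Suc k) = U k + u) \<and> U 0 = 0"
    proof -
      have "\<exists>U. \<forall>k. (U k \<in> X \<and> norm (x - U k) < r / 2^k \<and> (k = 0 \<longrightarrow> U k = 0)) \<and>
        (\<exists>u\<in>X. nb u (real m / 2^k) \<and> U (Suc k) = U k + u)"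
      proof (rule dependent_nat_choice)
        show "\<exists>z. z \<in> X \<and> norm (x - z) < r / 2^0 \<and> (0 = (0::nat) \<longrightarrow> z = 0)"
          using subspace_0[OF sub] xr by auto
        fix z k assume z: "z \<in> X \<and> norm (x - z) < r / 2^k \<and> (k = 0 \<longrightarrow> z = 0)"
        then obtain u where "u \<in> X" "nb u (real m / 2^k)" "norm (x - z - u) < r / 2^(Suc k)"
          using approx[of "x - z" k] xX sub by (metis subspace_diff)
        then show "\<exists>y. (y \<in> X \<and> norm (x - y) < r / 2^Suc k \<and> (Suc k = 0 \<longrightarrow> y = 0)) \<and>
            (\<exists>u\<in>X. nb u (real m / 2^k) \<and> y = z + u)"
          using z sub by (intro exI[of _ "z + u"]) (auto simp: subspace_add algebra_simps)
      qed
      then show ?thesis by blast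
    qed
    then obtain U u where U: "\<And>k. norm (x - U k) < r / 2^k" "U 0 = 0"
      and u: "\<And>k. u k \<in> X" "\<And>k. nb (u k) (real m / 2^k)" "\<And>k. U (Suc k) = U k + u k"
      by metis
    have Usum: "U n = (\<Sum>k<n. u k)" for n
      by (induction n) (auto simp: U u)
    have r0: "(\<lambda>k. r / 2^k) \<longlonglongrightarrow> 0"
      using tendsto_mult[OF tendsto_const[of r] LIMSEQ_power_zero[of "1/2::real"]]
      by (simp add: power_divide)
    have "(\<lambda>k. x - U k) \<longlonglongrightarrow> 0"
      by (rule Lim_null_comparison[OF _ r0]) (use U(1) in \<open>auto simp: less_imp_le\<close>)
    then have "U \<longlonglongrightarrow> x"
      using tendsto_diff[OF tendsto_const[of x]] by force
    then have usum: "u sums x" by (simp add: sums_def flip: Usum)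
    have geo: "(\<lambda>k. real m / 2^k) sums (2 * real m)"
      using sums_mult[OF geometric_sums[of "1/2::real"], of "real m"]
      by (simp add: power_divide mult.commute)
    have "summable (\<lambda>k. co (u k) n)" for n
    proof (rule summable_comparison_test')
      show "summable (\<lambda>k. (real m / 2^k) * inverse (norm (e n)))"
        using geo by (intro summable_mult2) (simp add: sums_iff)
      fix k
      have "\<bar>co (u k) n\<bar> * norm (e n) \<le> real m / 2^k"
        using nbD[OF u(2)[of k], of "{n}"] by simp
      then show "norm (co (u k) n) \<le> (real m / 2^k) * inverse (norm (e n))"
        using nz[of n] by (simp add: field_simps)
    qed
    then have "\<exists>c. \<forall>n. (\<lambda>k. co (u k) n) sums c n"
      by (intro exI[of _ "\<lambda>n. \<Sum>k. co (u k) n"]) (simp add: summable_sums)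
    then obtain c where c: "\<And>n. (\<lambda>k. co (u k) n) sums c n" by blast
    have cF: "(\<lambda>k. \<Sum>i\<in>F. co (u k) i *\<^sub>R e i) sums (\<Sum>i\<in>F. c i *\<^sub>R e i)" for F
      by (intro sums_sum sums_scaleR_left c)
    \<comment> \<open>Two limits must be exchanged: for each k the error \<open>?d N k\<close> tends
      to 0 as N grows, and it is dominated by the summable \<open>2 * (real m / 2^k)\<close>, so
      Tannery's theorem applies.\<close>
    have "(\<lambda>n. c n *\<^sub>R e n) sums x"
    proof -
      let ?d = "\<lambda>N k. (\<Sum>i<N. co (u k) i *\<^sub>R e i) - u k"
      have d2: "norm (?d N k) \<le> 2 * (real m / 2^k)" for N k
        using norm_triangle_ineq4[of "\<Sum>i<N. co (u k) i *\<^sub>R e i" "u k"]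
          nbD[OF u(2)[of k], of "{..<N}"] nb_norm[OF u(1,2), of k] by simp
      have gs: "summable (\<lambda>k. 2 * (real m / 2^k))"
        using geo by (intro summable_mult) (simp add: sums_iff)
      have lim: "(\<lambda>N. \<Sum>k. norm (?d N k)) \<longlonglongrightarrow> (\<Sum>k. 0)"
      proof (rule tannerys_theorem[THEN conjunct2, THEN conjunct2])
        show "(\<lambda>N. norm (?d N k)) \<longlonglongrightarrow> 0" for k
          using co[OF u(1)[of k]] unfolding sums_def
          by (intro tendsto_norm_zero) (rule LIM_zero)
        show "\<forall>\<^sub>F (k, N) in at_top \<times>\<^sub>F sequentially. norm (norm (?d N k)) \<le> 2 * (real m / 2^k)"
          using d2 by (intro always_eventually) auto
      qed (use gs in auto)
      have bd: "norm ((\<Sum>i<N. c i *\<^sub>R e i) - x) \<le> (\<Sum>k. norm (?d N k))" for N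
      proof -
        have "(\<Sum>i<N. c i *\<^sub>R e i) - x = (\<Sum>k. ?d N k)"
          by (rule sums_unique[OF sums_diff[OF cF usum]])
        moreover have "summable (\<lambda>k. norm (?d N k))"
          by (rule summable_comparison_test'[OF gs]) (use d2 in auto)
        ultimately show ?thesis
          using summable_norm[of "?d N"] by simp
      qed
      have "(\<lambda>N. (\<Sum>i<N. c i *\<^sub>R e i) - x) \<longlonglongrightarrow> 0"
        by (rule Lim_null_comparison[OF always_eventually lim[unfolded suminf_zero]]) (blast intro: bd)
      then show ?thesis unfolding sums_def by (rule LIM_zero_cancel)
    qed
    then have cx: "c = co x" by (rule uniq[OF xX])
    show ?thesis
      unfolding nb_def
    proof (intro allI impI)
      fix F :: "nat set" assume F: "finite F"
      have "norm (\<Sum>i\<in>F. c i *\<^sub>R e i) \<le> (\<Sum>k. real m / 2^k)"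
        using cF[of F] geo nbD[OF u(2) F]
        by (metis (no_types, lifting) norm_suminf_le sums_unique sums_summable)
      then show "norm (\<Sum>i\<in>F. co x i *\<^sub>R e i) \<le> 2 * real m"
        using geo cx by (simp add: sums_iff)
    qed
  qed
  \<comment> \<open>Scaling a vector to norm r/2 brings it within reach of \<open>main\<close>;
    scaling back turns the bound 2m into 4m/r times the norm.\<close>
  have "suppression (4 * real m / r) e"
    unfolding suppression_def
  proof (intro allI impI)
    fix F G :: "nat set" and a
    assume F: "finite F" and G: "G \<subseteq> F"
    let ?x = "\<Sum>i\<in>F. a i *\<^sub>R e i"
    have xX: "?x \<in> X" using sub eX by (intro subspace_sum subspace_scale)
    have "(\<lambda>n. (if n \<in> F then a n else 0) *\<^sub>R e n) sums ?x"
      using sums_If_finite_set[OF F, of "\<lambda>n. a n *\<^sub>R e n"] by (simp add: if_distrib if_distribR cong: if_cong)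
    then have coF: "co ?x = (\<lambda>n. if n \<in> F then a n else 0)"
      using uniq[OF xX] by metis
    have sG: "(\<Sum>i\<in>G. a i *\<^sub>R e i) = (\<Sum>i\<in>G. co ?x i *\<^sub>R e i)"
      using G by (intro sum.cong) (auto simp: coF)
    show "norm (\<Sum>i\<in>G. a i *\<^sub>R e i) \<le> 4 * real m / r * norm ?x"
    proof (cases "?x = 0")
      case True
      then have "co ?x = (\<lambda>n. 0)"
        using uniq[OF xX, of "\<lambda>n. 0"] by simp
      then show ?thesis unfolding sG by (simp only: scaleR_zero_left sum.neutral_const True) simp
    next
      case False
      define s where "s = r / (2 * norm ?x)"
      have s: "s > 0" using False r(1) by (simp add: s_def)
      have "s *\<^sub>R ?x \<in> X" "norm (s *\<^sub>R ?x) < r"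
        using xX sub False r(1) s by (auto simp: subspace_scale) (simp add: s_def)
      then have "nb (s *\<^sub>R ?x) (2 * real m)" by (rule main)
      then have "norm (\<Sum>i\<in>G. co (s *\<^sub>R ?x) i *\<^sub>R e i) \<le> 2 * real m"
        using nbD F G finite_subset by blast
      moreover have "co (s *\<^sub>R ?x) i = s * co ?x i" for i
        using lin[OF xX xX, of s 0] by simp
      then have "(\<Sum>i\<in>G. co (s *\<^sub>R ?x) i *\<^sub>R e i) = s *\<^sub>R (\<Sum>i\<in>G. co ?x i *\<^sub>R e i)"
        by (simp add: scaleR_sum_right)
      ultimately have "s * norm (\<Sum>i\<in>G. a i *\<^sub>R e i) \<le> 2 * real m"
        unfolding sG using s by simp
      then show ?thesis using False r(1) by (simp add: s_def field_simps)
    qed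
  qed
  then show ?thesis using nz that by blast
qed

section \<open>Continuous functions on the Cantor set\<close>

text \<open>The library makes the bounded continuous functions a Banach space only over a metric domain,
hence the discrete metric on \<open>bool\<close>.\<close>

instantiation bool :: metric_space
begin

definition dist_bool :: "bool \<Rightarrow> bool \<Rightarrow> real" where
  "dist_bool a b = of_bool (a \<noteq> b)"

definition uniformity_bool :: "(bool \<times> bool) filter" where
  "uniformity_bool = (INF e\<in>{0<..}. principal {(x, y). dist x y < e})"

instance
proof
  show "open U \<longleftrightarrow> (\<forall>x\<in>U. \<forall>\<^sub>F (x', y) in uniformity. x' = x \<longrightarrow> y \<in> U)" for U :: "bool set"
  proof -
    have "(\<forall>x\<in>U. \<forall>\<^sub>F (x', y) in uniformity. x' = x \<longrightarrow> y \<in> U)"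
      unfolding uniformity_bool_def
      by (subst eventually_INF_base)
         (auto simp: eventually_principal dist_bool_def Bex_def
           intro!: exI[of _ "1::real"] intro: exI[of _ "min _ _ :: real"])
    then show ?thesis by (simp add: open_discrete)
  qed
qed (auto simp: dist_bool_def uniformity_bool_def)

end

instance bcontfun :: (metric_space, banach) banach ..

lemma C2N_apply_simps [simp]:
  fixes f g :: C2N
  shows "apply_bcontfun (f + g) x = f x + g x" "apply_bcontfun (f - g) x = f x - g x"
    "apply_bcontfun (c *\<^sub>R f) x = c * f x" "apply_bcontfun 0 x = 0"
  by (simp_all add: plus_bcontfun.rep_eq minus_bcontfun.rep_eq scaleR_bcontfun.rep_eq zero_bcontfun.rep_eq)

lemma C2N_norm_bounded: "\<bar>apply_bcontfun f x\<bar> \<le> norm (f :: C2N)"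
  using norm_bounded[of f x] by simp

lemma C2N_norm_bound: "(\<And>x. \<bar>apply_bcontfun f x\<bar> \<le> b) \<Longrightarrow> norm (f :: C2N) \<le> b"
  by (rule norm_bound) simp

lemma bounded_linear_C2N_apply: "bounded_linear (\<lambda>f::C2N. apply_bcontfun f x)"
  by (rule bounded_linear_intro[where K = 1]) (use C2N_norm_bounded in auto)

lemma C2N_sum_apply [simp]: "apply_bcontfun (\<Sum>i\<in>A. f i :: C2N) x = (\<Sum>i\<in>A. f i x)"
  by (induction A rule: infinite_finite_induct) auto

lemma compact_cantor: "compact (UNIV :: (nat \<Rightarrow> bool) set)"
proof -
  have "compact_space (euclidean :: bool topology)"
    by (simp add: compact_space_def finite_imp_compact)
  then have "compact_space (product_topology (\<lambda>_::nat. euclidean :: bool topology) UNIV)"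
    by (simp add: compact_space_product_topology)
  then show ?thesis
    by (simp add: euclidean_product_topology compact_space_def)
qed

lemma C2N_norm_attained:
  fixes f :: C2N
  obtains x where "\<bar>apply_bcontfun f x\<bar> = norm f"
proof -
  have "continuous_on UNIV (\<lambda>x. \<bar>apply_bcontfun f x\<bar>)"
    by (intro continuous_intros) auto
  then obtain x where x: "\<And>y. \<bar>apply_bcontfun f y\<bar> \<le> \<bar>apply_bcontfun f x\<bar>"
    using continuous_attains_sup[OF compact_cantor, of "\<lambda>x. \<bar>apply_bcontfun f x\<bar>"] by auto
  then have "norm f \<le> \<bar>apply_bcontfun f x\<bar>" by (rule C2N_norm_bound)
  then show ?thesis using C2N_norm_bounded[of f x] that by (simp add: antisym)
qed

text \<open>Simons' lemma. Choose \<open>h n\<close> in the convex hull of the \<open>n\<close>-th tail so that the partial sum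
\<open>g (Suc n) = g n + (1/2)^n *\<^sub>R h n\<close> has almost minimal norm. Comparing \<open>h n\<close> with
\<open>(2/3) *\<^sub>R h n + (1/3) *\<^sub>R h (Suc n)\<close> shows that the norms of the partial sums grow by at least
\<open>(c/2) * (1/2)^n\<close>. At a point where the full sum attains its norm the functions \<open>y n\<close> cannot tend
to zero.\<close>

lemma Simons_convex_lower_bound:
  fixes y :: "nat \<Rightarrow> C2N"
  assumes bdd: "\<And>n. norm (y n) \<le> B"
    and conv: "\<And>h. h \<in> convex hull (range y) \<Longrightarrow> norm h \<ge> c" and c: "c > 0"
  shows "\<exists>x. \<not> (\<lambda>n. y n x) \<longlonglongrightarrow> 0"
proof -
  define H where "H n = convex hull (y ` {n..})" for n
  have H_mono: "H m \<subseteq> H n" if "n \<le> m" for m n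
    unfolding H_def by (intro hull_mono image_mono) (use that in auto)
  have H_ne: "y n \<in> H n" for n
    unfolding H_def by (intro hull_inc) auto
  have HB: "norm h \<le> B" if "h \<in> H n" for h n
  proof -
    have "H n \<subseteq> cball 0 B"
      unfolding H_def by (intro hull_minimal) (use bdd in auto)
    then show ?thesis using that by auto
  qed
  have Hc: "norm h \<ge> c" if "h \<in> H n" for h n
    using conv H_mono[of 0 n] that by (auto simp: H_def atLeast_0)
  have cvx: "convex (H n)" for n unfolding H_def by (rule convex_convex_hull)
  \<comment> \<open>The errors decay like (1/4)^n, faster than the increments of order (1/2)^n that
    they perturb; the factor 1/16 leaves room in the induction for
    \<open>\<Delta>_low\<close>.\<close>
  define \<epsilon> where "\<epsilon> n = c / 16 * (1/4)^n" for n :: nat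
  have eps: "\<epsilon> n > 0" for n using c by (simp add: \<epsilon>_def)
  have step: "\<exists>h\<in>H n. \<forall>k\<in>H n. norm (g + (1/2)^n *\<^sub>R h) \<le> norm (g + (1/2)^n *\<^sub>R k) + \<epsilon> n" for g n
  proof -
    let ?S = "(\<lambda>k. norm (g + (1/2)^n *\<^sub>R k)) ` H n"
    have ne: "?S \<noteq> {}" using H_ne by auto
    have bb: "bdd_below ?S" by (rule bdd_belowI[of _ 0]) auto
    obtain s where s: "s \<in> ?S" "s < Inf ?S + \<epsilon> n"
      using cInf_lessD[OF ne, of "Inf ?S + \<epsilon> n"] eps[of n] by auto
    then obtain h where h: "h \<in> H n" "s = norm (g + (1/2)^n *\<^sub>R h)" by auto
    have "norm (g + (1/2)^n *\<^sub>R h) \<le> norm (g + (1/2)^n *\<^sub>R k) + \<epsilon> n" if "k \<in> H n" for k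
      using cInf_lower[OF _ bb, of "norm (g + (1/2)^n *\<^sub>R k)"] that s(2) h(2) by auto
    then show ?thesis using h by blast
  qed
  have "\<exists>g. \<forall>n. (n = 0 \<longrightarrow> g n = 0) \<and> (\<exists>h\<in>H n. g (Suc n) = g n + (1/2)^n *\<^sub>R h \<and>
      (\<forall>k\<in>H n. norm (g (Suc n)) \<le> norm (g n + (1/2)^n *\<^sub>R k) + \<epsilon> n))"
  proof (rule dependent_nat_choice)
    show "\<exists>z. (0::nat) = 0 \<longrightarrow> z = 0" by auto
    fix g and n :: nat
    show "\<exists>g'. (Suc n = 0 \<longrightarrow> g' = 0) \<and> (\<exists>h\<in>H n. g' = g + (1/2)^n *\<^sub>R h \<and> (\<forall>k\<in>H n. norm g' \<le> norm (g + (1/2)^n *\<^sub>R k) + \<epsilon> n))"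
      using step[of n g] by blast
  qed
  then obtain g h where g0: "g 0 = 0" and h: "\<And>n. h n \<in> H n"
    and gS: "\<And>n. g (Suc n) = g n + (1/2)^n *\<^sub>R h n"
    and gmin: "\<And>n k. k \<in> H n \<Longrightarrow> norm (g (Suc n)) \<le> norm (g n + (1/2)^n *\<^sub>R k) + \<epsilon> n"
    by metis
  define \<Delta> where "\<Delta> n = norm (g (Suc n)) - norm (g n)" for n
  have \<Delta>_step: "(1/2) * \<Delta> n \<le> \<Delta> (Suc n) + (3/2) * \<epsilon> n" for n
  proof -
    have "h (Suc n) \<in> H n" using h H_mono[of n "Suc n"] by auto
    \<comment> \<open>Weights in the ratio 2 : 1 of the step lengths (1/2)^n and (1/2)^(n+1) place
      the competing point on the segment from \<open>g n\<close> to
      \<open>g (Suc (Suc n))\<close>.\<close>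
    then have "(2/3) *\<^sub>R h n + (1/3) *\<^sub>R h (Suc n) \<in> H n"
      using convexD[OF cvx h[of n], of "h (Suc n)" "2/3" "1/3"] by simp
    then have "norm (g (Suc n)) \<le> norm (g n + (1/2)^n *\<^sub>R ((2/3) *\<^sub>R h n + (1/3) *\<^sub>R h (Suc n))) + \<epsilon> n"
      by (rule gmin)
    also have "g n + (1/2)^n *\<^sub>R ((2/3) *\<^sub>R h n + (1/3) *\<^sub>R h (Suc n)) =
        (1/3) *\<^sub>R g n + (2/3) *\<^sub>R g (Suc (Suc n))"
      unfolding gS[of "Suc n"] gS[of n]
      by (rule bcontfun_eqI) (simp add: field_simps)
    also have "norm \<dots> \<le> (1/3) * norm (g n) + (2/3) * norm (g (Suc (Suc n)))"
      using norm_triangle_ineq[of "(1/3) *\<^sub>R g n" "(2/3) *\<^sub>R g (Suc (Suc n))"] by simp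
    finally show ?thesis by (simp add: \<Delta>_def)
  qed
  \<comment> \<open>The second summand feeds the induction: after halving it contributes c/4 times
    (1/4)^n, the next stage asks for c/8 times (1/4)^n, and the difference pays for the error 3c/32
    times (1/4)^n.\<close>
  have \<Delta>_low: "\<Delta> n \<ge> (1/2)^n * (c/2 + c/2 * (1/2)^n)" for n
  proof (induction n)
    case 0
    then show ?case using Hc[OF h[of 0]] by (simp add: \<Delta>_def gS g0)
  next
    case (Suc n)
    have "(1/4::real)^n = (1/2)^n * (1/2)^n" by (simp flip: power_mult_distrib)
    then have "\<Delta> (Suc n) \<ge> (1/2) * ((1/2)^n * (c/2 + c/2 * (1/2)^n)) - (3/2) * (c/16 * ((1/2)^n * (1/2)^n))"
      using Suc \<Delta>_step[of n] by (simp add: \<epsilon>_def)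
    moreover have "0 \<le> c * ((1/2)^n * (1/2)^n)" using c by simp
    ultimately show ?case by (simp add: algebra_simps)
  qed
  have \<Delta>_half: "\<Delta> n \<ge> (c/2) * (1/2)^n" for n
  proof -
    have "0 \<le> c * ((1/2)^n * (1/2)^n)" using c by simp
    then show ?thesis using \<Delta>_low[of n] by (simp add: algebra_simps)
  qed
  have gsum: "g n = (\<Sum>k<n. (1/2)^k *\<^sub>R h k)" for n
    by (induction n) (auto simp: g0 gS)
  have hB: "norm ((1/2)^k *\<^sub>R h k) \<le> B * (1/2)^k" for k
    using HB[OF h[of k]] by (simp add: field_simps)
  have "summable (\<lambda>k. (1/2)^k *\<^sub>R h k)"
    by (rule summable_comparison_test'[where g = "\<lambda>k. B * (1/2)^k"])
       (use hB in \<open>auto intro!: summable_mult summable_geometric\<close>)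
  then obtain G where G: "(\<lambda>k. (1/2)^k *\<^sub>R h k) sums G" by (auto simp: summable_def)
  then have gG: "g \<longlonglongrightarrow> G" by (simp add: sums_def flip: gsum)
  obtain x where x: "\<bar>G x\<bar> = norm G" by (rule C2N_norm_attained)
  show ?thesis
  proof (intro exI notI)
    assume "(\<lambda>n. y n x) \<longlonglongrightarrow> 0"
    then obtain N where N: "\<And>n. n \<ge> N \<Longrightarrow> \<bar>y n x\<bar> < c/4"
      using LIMSEQ_D[of _ 0 "c/4"] c by fastforce
    have hx: "\<bar>h k x\<bar> \<le> c/4" if "k \<ge> N" for k
    proof -
      have "H k \<subseteq> {f. \<bar>apply_bcontfun f x\<bar> \<le> c/4}"
        unfolding H_def
      proof (rule hull_minimal)
        show "y ` {k..} \<subseteq> {f. \<bar>apply_bcontfun f x\<bar> \<le> c/4}"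
          using N that by (auto simp: less_imp_le)
        show "convex {f :: C2N. \<bar>apply_bcontfun f x\<bar> \<le> c/4}"
        proof (rule convexI)
          fix f1 f2 :: C2N and u v :: real
          assume *: "f1 \<in> {f. \<bar>apply_bcontfun f x\<bar> \<le> c/4}" "f2 \<in> {f. \<bar>apply_bcontfun f x\<bar> \<le> c/4}"
            "0 \<le> u" "0 \<le> v" "u + v = 1"
          have "\<bar>u * f1 x + v * f2 x\<bar> \<le> u * \<bar>f1 x\<bar> + v * \<bar>f2 x\<bar>"
            using * abs_triangle_ineq[of "u * f1 x" "v * f2 x"] by (simp add: abs_mult)
          also have "\<dots> \<le> u * (c/4) + v * (c/4)"
            using * by (intro add_mono mult_left_mono) auto
          also have "\<dots> = c/4" using *(5) by (metis distrib_right mult_1)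
          finally show "u *\<^sub>R f1 + v *\<^sub>R f2 \<in> {f. \<bar>apply_bcontfun f x\<bar> \<le> c/4}" by simp
        qed
      qed
      then show ?thesis using h by auto
    qed
    \<comment> \<open>From N on the value at x gains at most c/4 per unit of weight, while by
      \<open>low\<close> the norm gains at least c/2; the gap persists in the limit, although G
      attains its norm at x.\<close>
    have up: "\<bar>g (N + m) x\<bar> \<le> norm (g N) + (c/4) * (\<Sum>k<m. (1/2)^(N + k))" for m
    proof (induction m)
      case 0
      then show ?case using C2N_norm_bounded by simp
    next
      case (Suc m)
      have "\<bar>g (N + Suc m) x\<bar> \<le> \<bar>g (N + m) x\<bar> + (1/2)^(N+m) * \<bar>h (N + m) x\<bar>"
        using abs_triangle_ineq[of "g (N + m) x" "(1/2)^(N+m) * h (N + m) x"]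
        by (simp add: gS abs_mult)
      also have "\<dots> \<le> (norm (g N) + (c/4) * (\<Sum>k<m. (1/2)^(N + k))) + (1/2)^(N+m) * (c/4)"
        using Suc hx[of "N + m"] by (intro add_mono mult_left_mono) auto
      finally show ?case by (simp add: algebra_simps)
    qed
    have low: "norm (g (N + m)) \<ge> norm (g N) + (c/2) * (\<Sum>k<m. (1/2)^(N + k))" for m
    proof (induction m)
      case (Suc m)
      have "norm (g (N + Suc m)) = norm (g (N + m)) + \<Delta> (N + m)" by (simp add: \<Delta>_def)
      then show ?case using Suc \<Delta>_half[of "N + m"] by (simp add: algebra_simps)
    qed simp
    have "(\<lambda>m. norm (g (m + N)) - \<bar>g (m + N) x\<bar>) \<longlonglongrightarrow> norm G - \<bar>G x\<bar>"
      by (intro tendsto_intros LIMSEQ_ignore_initial_segment gG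
          bounded_linear.tendsto[OF bounded_linear_C2N_apply])
    moreover have "norm (g (m + N)) - \<bar>g (m + N) x\<bar> \<ge> (c/4) * (1/2)^N" if "m \<ge> 1" for m
    proof -
      have "(c/4) * (1/2)^N \<le> (c/4) * (\<Sum>k<m. (1/2)^(N + k))"
      proof (rule mult_left_mono)
        have "(\<Sum>k\<in>{0}. (1/2::real)^(N + k)) \<le> (\<Sum>k<m. (1/2)^(N + k))"
          by (rule sum_mono2) (use that in auto)
        then show "(1/2::real)^N \<le> (\<Sum>k<m. (1/2)^(N + k))" by simp
      qed (use c in auto)
      then show ?thesis using up[of m] low[of m] by (simp add: add.commute)
    qed
    ultimately have "norm G - \<bar>G x\<bar> \<ge> (c/4) * (1/2)^N"
      using LIMSEQ_le_const by blast
    moreover have "(c/4) * (1/2)^N > 0" using c by simp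
    ultimately show False using x by simp
  qed
qed

section \<open>Finitely determined functions and a countable dense set\<close>

lemma Bcontfun_cantor_apply:
  fixes f :: "(nat \<Rightarrow> bool) \<Rightarrow> real"
  assumes "continuous_on UNIV f"
  shows "apply_bcontfun (Bcontfun f) = f"
  using assms compact_continuous_image[OF assms compact_cantor]
  by (intro Bcontfun_inverse) (auto simp: bcontfun_def compact_imp_bounded)

lemma tendsto_baire_iff:
  fixes x :: "nat \<Rightarrow> nat \<Rightarrow> 'a::discrete_topology"
  shows "x \<longlonglongrightarrow> a \<longleftrightarrow> (\<forall>i. \<forall>\<^sub>F n in sequentially. x n i = a i)"
proof -
  have "x \<longlonglongrightarrow> a \<longleftrightarrow> limitin (product_topology (\<lambda>_. euclidean) UNIV) x a sequentially"
    by (simp only: euclidean_product_topology limitin_canonical_iff)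
  also have "\<dots> \<longleftrightarrow> (\<forall>i. (\<lambda>n. x n i) \<longlonglongrightarrow> a i)"
    by (simp add: limitin_componentwise limitin_canonical_iff)
  finally show ?thesis by (simp add: tendsto_discrete)
qed

lemma continuous_finitely_determined:
  fixes f :: "(nat \<Rightarrow> bool) \<Rightarrow> real"
  assumes "\<And>x y. (\<And>i. i < N \<Longrightarrow> x i = y i) \<Longrightarrow> f x = f y"
  shows "continuous_on UNIV f"
  unfolding continuous_on_def
proof
  fix x :: "nat \<Rightarrow> bool"
  let ?U = "\<Inter>i\<in>{..<N}. (\<lambda>y. y i) -` {x i} :: (nat \<Rightarrow> bool) set"
  have "open ?U"
    by (intro open_INT ballI open_vimage open_discrete continuous_on_product_coordinates) auto
  moreover have "x \<in> ?U" by simp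
  moreover have "f y = f x" if "y \<in> ?U" for y using that by (intro assms) auto
  ultimately have "\<forall>\<^sub>F y in at x within UNIV. f y = f x"
    unfolding eventually_at_topological by blast
  then show "(f \<longlongrightarrow> f x) (at x within UNIV)" by (rule tendsto_eventually)
qed

text \<open>Uniform continuity for the product topology: offending pairs at every depth would, by
  compactness, have subsequences with one common limit.\<close>

lemma C2N_uniformly_determined:
  fixes f :: C2N
  assumes "\<epsilon> > 0"
  obtains N where "\<And>x y. (\<And>i. i < N \<Longrightarrow> x i = y i) \<Longrightarrow> \<bar>f x - f y\<bar> < \<epsilon>"
proof (rule ccontr)
  assume "\<not> thesis"
  then have "\<forall>N. \<exists>x y. (\<forall>i<N. x i = y i) \<and> \<not> \<bar>f x - f y\<bar> < \<epsilon>"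
    using that by metis
  then obtain x y where xy: "\<And>N i. i < N \<Longrightarrow> x N i = y N i" "\<And>N. \<not> \<bar>f (x N) - f (y N)\<bar> < \<epsilon>"
    by metis
  obtain l r where r: "strict_mono (r :: nat \<Rightarrow> nat)" "(x \<circ> r) \<longlonglongrightarrow> l"
    using compact_cantor unfolding compact_def by blast
  have "(y \<circ> r) \<longlonglongrightarrow> l"
    unfolding tendsto_baire_iff
  proof
    fix i
    have "\<forall>\<^sub>F n in sequentially. (x \<circ> r) n i = l i"
      using r(2) by (simp add: tendsto_baire_iff)
    moreover have "\<forall>\<^sub>F n in sequentially. i < n" by (rule eventually_gt_at_top)
    ultimately show "\<forall>\<^sub>F n in sequentially. (y \<circ> r) n i = l i"
    proof eventually_elim
      case (elim n)
      then have "i < r n" using seq_suble[OF r(1), of n] by linarith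
      then show ?case using xy(1) elim by simp
    qed
  qed
  moreover have "(\<lambda>n. f (z n)) \<longlonglongrightarrow> f l" if "z \<longlonglongrightarrow> l" for z
    by (rule continuous_on_tendsto_compose[OF continuous_on_apply_bcontfun[of UNIV f] that]) auto
  ultimately have "(\<lambda>n. f ((x \<circ> r) n) - f ((y \<circ> r) n)) \<longlonglongrightarrow> f l - f l"
    using r(2) by (intro tendsto_diff) blast+
  then have "\<exists>n. \<bar>f (x (r n)) - f (y (r n))\<bar> < \<epsilon>"
    using LIMSEQ_D[of _ 0 \<epsilon>] assms by fastforce
  then show False using xy(2) by blast
qed

lemma C2N_dense_sequence:
  obtains d :: "nat \<Rightarrow> C2N" where "\<And>n. d n \<noteq> 0"
    "\<forall>f \<epsilon>. f \<noteq> 0 \<longrightarrow> \<epsilon> > 0 \<longrightarrow> (\<exists>n. norm (f - d n) < \<epsilon>)"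
proof -
  \<comment> \<open>\<open>val (N, qs)\<close> is a step function on the cylinders of length N: the
    code of an initial segment is an index into the list of rationals, and the value past the end of
    the list is 0.\<close>
  define val :: "nat \<times> rat list \<Rightarrow> (nat \<Rightarrow> bool) \<Rightarrow> real" where
    "val p x = (let k = to_nat (map x [0..<fst p]) in if k < length (snd p) then of_rat (snd p ! k) else 0)"
    for p x
  define st :: "nat \<times> rat list \<Rightarrow> C2N" where "st p = Bcontfun (val p)" for p
  have st: "apply_bcontfun (st p) = val p" for p
    unfolding st_def
  proof (rule Bcontfun_cantor_apply, rule continuous_finitely_determined[where N = "fst p"])
    fix x y :: "nat \<Rightarrow> bool" assume "\<And>i. i < fst p \<Longrightarrow> x i = y i"
    then have "map x [0..<fst p] = map y [0..<fst p]" by simp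
    then show "val p x = val p y" by (simp only: val_def)
  qed
  have dense: "\<exists>p. norm (f - st p) < \<epsilon>" if "\<epsilon> > 0" for f \<epsilon>
  proof -
    have "\<epsilon>/2 > 0" using that by simp
    obtain N where N: "\<And>x y. (\<And>i. i < N \<Longrightarrow> x i = y i) \<Longrightarrow> \<bar>f x - f y\<bar> < \<epsilon>/2"
      by (rule C2N_uniformly_determined[OF \<open>\<epsilon>/2 > 0\<close>, of f]) (rule that, blast)
    \<comment> \<open>One point of each cylinder, extended by False beyond N. Sampling f there costs
      at most \<epsilon>/2 and rounding to a rational \<epsilon>/4.\<close>
    define rep where "rep bs = (\<lambda>i. i < N \<and> bs ! i)" for bs :: "bool list"
    have "\<exists>q. \<bar>of_rat q - f (rep (from_nat k))\<bar> < \<epsilon>/4" for k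
    proof -
      obtain q where "f (rep (from_nat k)) < of_rat q" "of_rat q < f (rep (from_nat k)) + \<epsilon>/4"
        using of_rat_dense[of "f (rep (from_nat k))" "f (rep (from_nat k)) + \<epsilon>/4"] \<open>\<epsilon>/2 > 0\<close> by auto
      then show ?thesis by (intro exI[of _ q]) auto
    qed
    then obtain q where q: "\<And>k. \<bar>of_rat (q k) - f (rep (from_nat k))\<bar> < \<epsilon>/4" by metis
    have "finite (to_nat ` {bs :: bool list. length bs = N})"
      using finite_lists_length_eq[of "UNIV :: bool set" N] by simp
    then obtain M where M: "\<And>bs :: bool list. length bs = N \<Longrightarrow> to_nat bs < M"
      using finite_nat_set_iff_bounded by auto
    let ?p = "(N, map q [0..<M])"
    have "\<bar>(f - st ?p) x\<bar> \<le> 3 * \<epsilon> / 4" for x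
    proof -
      let ?bs = "map x [0..<N]"
      have "val ?p x = of_rat (q (to_nat ?bs))"
        using M[of ?bs] by (simp add: val_def)
      moreover have "\<bar>of_rat (q (to_nat ?bs)) - f (rep ?bs)\<bar> < \<epsilon>/4"
        using q[of "to_nat ?bs"] by simp
      moreover have "\<bar>f (rep ?bs) - f x\<bar> < \<epsilon>/2"
        by (rule N) (simp add: rep_def)
      moreover have "(f - st ?p) x = f x - val ?p x" by (simp add: st)
      ultimately show ?thesis by linarith
    qed
    then have "norm (f - st ?p) \<le> 3 * \<epsilon> / 4" by (rule C2N_norm_bound)
    then show ?thesis using that by (intro exI[of _ ?p]) simp
  qed
  \<comment> \<open>Vectors of a perturbed basis must be nonzero. Removing 0 keeps density at a
    nonzero f: an approximation closer than \<open>norm f\<close> is never 0.\<close>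
  define S where "S = range st - {0}"
  have "\<exists>g\<in>S. norm (f - g) < \<epsilon>" if fe: "f \<noteq> 0" "\<epsilon> > 0" for f \<epsilon>
  proof -
    obtain p where p: "norm (f - st p) < min \<epsilon> (norm f)"
      using dense[of "min \<epsilon> (norm f)" f] fe by auto
    then have "st p \<noteq> 0" by auto
    then show ?thesis using p by (auto simp: S_def)
  qed
  moreover have "countable S" by (simp add: S_def)
  moreover have "const_bcontfun 1 \<noteq> (0 :: C2N)"
    by (metis C2N_apply_simps(4) const_bcontfun.rep_eq zero_neq_one)
  ultimately show ?thesis
    using that[of "from_nat_into S"]
    by (metis DiffD2 S_def empty_iff from_nat_into from_nat_into_surj insertCI zero_less_one)
qed

section \<open>Amalgamating a family of functions along chains\<close>

text \<open>A point \<open>x\<close> of the Cantor set codes a set \<open>S\<close> of indices (even coordinates) and another point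
of the Cantor set (odd coordinates). The elements of \<open>S\<close> comparable to all smaller elements of \<open>S\<close>
form a chain, which is \<open>S\<close> itself if \<open>S\<close> is a chain. Since being accepted depends on finitely many
coordinates, \<open>amalgam cmp D n\<close> is continuous.\<close>

definition accepted :: "(nat \<Rightarrow> nat \<Rightarrow> bool) \<Rightarrow> (nat \<Rightarrow> bool) \<Rightarrow> nat set" where
  "accepted cmp x = {n. x (2 * n) \<and> (\<forall>m<n. x (2 * m) \<longrightarrow> cmp m n)}"

definition amalgam :: "(nat \<Rightarrow> nat \<Rightarrow> bool) \<Rightarrow> (nat \<Rightarrow> C2N) \<Rightarrow> nat \<Rightarrow> C2N" where
  "amalgam cmp D n = Bcontfun (\<lambda>x. of_bool (x (2 * n)) *
     (\<Prod>m<n. of_bool (x (2 * m) \<longrightarrow> cmp m n)) * D n (\<lambda>i. x (2 * i + 1)))"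

lemma amalgam_apply:
  "apply_bcontfun (amalgam cmp D n) x =
     (if n \<in> accepted cmp x then D n (\<lambda>i. x (2 * i + 1)) else 0)"
proof -
  have dis: "continuous_on UNIV (g :: bool \<Rightarrow> real)" for g
    by (subst continuous_on_open_vimage) (auto simp: open_discrete)
  have c: "continuous_on UNIV (\<lambda>x :: nat \<Rightarrow> bool. g (x k))" for g :: "bool \<Rightarrow> real" and k
    by (rule continuous_on_compose2[OF dis continuous_on_product_coordinates]) auto
  have "continuous_on UNIV (\<lambda>x. of_bool (x (2 * n)) *
     (\<Prod>m<n. of_bool (x (2 * m) \<longrightarrow> cmp m n)) * D n (\<lambda>i. x (2 * i + 1)))"
  proof (intro continuous_on_mult continuous_on_prod)
    show "continuous_on UNIV (\<lambda>x :: nat \<Rightarrow> bool. of_bool (x (2 * n)) :: real)"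
      by (rule c)
    show "continuous_on UNIV (\<lambda>x :: nat \<Rightarrow> bool. of_bool (x (2 * m) \<longrightarrow> cmp m n) :: real)" for m
      by (rule c)
    have "continuous_on UNIV (\<lambda>x :: nat \<Rightarrow> bool. \<lambda>i::nat. x (2 * i + 1))"
      by (intro continuous_on_coordinatewise_then_product continuous_on_product_coordinates)
    then show "continuous_on UNIV (\<lambda>x. D n (\<lambda>i. x (2 * i + 1)))"
      by (rule continuous_on_compose2[OF continuous_on_apply_bcontfun]) auto
  qed
  then have "apply_bcontfun (amalgam cmp D n) x = of_bool (x (2 * n)) *
     (\<Prod>m<n. of_bool (x (2 * m) \<longrightarrow> cmp m n)) * D n (\<lambda>i. x (2 * i + 1))"
    unfolding amalgam_def by (simp add: Bcontfun_cantor_apply)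
  also have "(\<Prod>m<n. of_bool (x (2 * m) \<longrightarrow> cmp m n)) =
      (of_bool (\<forall>m<n. x (2 * m) \<longrightarrow> cmp m n) :: real)"
  proof (cases "\<forall>m<n. x (2 * m) \<longrightarrow> cmp m n")
    case True
    then show ?thesis by (auto intro!: prod.neutral)
  next
    case False
    then have "\<exists>m\<in>{..<n}. of_bool (x (2 * m) \<longrightarrow> cmp m n) = (0::real)" by auto
    then have "(\<Prod>m<n. of_bool (x (2 * m) \<longrightarrow> cmp m n)) = (0::real)"
      by (intro prod_zero) auto
    then show ?thesis using False by simp
  qed
  finally show ?thesis by (auto simp: accepted_def)
qed

section \<open>The amalgam space and its norm\<close>

locale amalgamation =
  fixes cmp :: "nat \<Rightarrow> nat \<Rightarrow> bool" and D :: "nat \<Rightarrow> C2N"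
  assumes cmp_refl: "cmp n n" and cmp_sym: "cmp m n \<Longrightarrow> cmp n m"
    and D_nonzero: "D n \<noteq> 0"
begin

text \<open>Chains are the cliques of a comparability graph; no order on the indices is fixed, and
  subsets of chains are again chains.\<close>

definition chain :: "nat set \<Rightarrow> bool" where
  "chain C \<longleftrightarrow> (\<forall>m\<in>C. \<forall>n\<in>C. cmp m n)"

abbreviation E :: "nat \<Rightarrow> C2N" where "E \<equiv> amalgam cmp D"

lemma chain_subset: "chain C \<Longrightarrow> B \<subseteq> C \<Longrightarrow> chain B"
  by (auto simp: chain_def)

lemma chain_accepted: "chain (accepted cmp x)"
  unfolding chain_def accepted_def
  using cmp_refl cmp_sym by (metis (no_types, lifting) linorder_neqE_nat mem_Collect_eq)

text \<open>The point of the Cantor set that interleaves C with t accepts exactly C, so every value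
  of the chain sum is a value of the amalgamated sum.\<close>

lemma norm_chain_le:
  assumes "chain C" "C \<subseteq> F" "finite F"
  shows "norm (\<Sum>n\<in>C. a n *\<^sub>R D n) \<le> norm (\<Sum>n\<in>F. a n *\<^sub>R E n)"
proof (rule C2N_norm_bound)
  fix t
  define x where "x k = (if even k then k div 2 \<in> C else t (k div 2))" for k
  have acc: "accepted cmp x = C"
    using assms(1) by (auto simp: accepted_def x_def chain_def)
  have odd: "(\<lambda>i. x (Suc (2 * i))) = t" by (auto simp: x_def)
  have "(\<Sum>n\<in>F. a n *\<^sub>R E n) x = (\<Sum>n\<in>F. if n \<in> C then a n * D n t else 0)"
    by (auto simp: amalgam_apply acc odd intro!: sum.cong)
  also have "\<dots> = (\<Sum>n\<in>C. a n * D n t)"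
    using assms(2,3) by (simp add: sum.inter_restrict[symmetric] Int_absorb1)
  finally show "\<bar>(\<Sum>n\<in>C. a n *\<^sub>R D n) t\<bar> \<le> norm (\<Sum>n\<in>F. a n *\<^sub>R E n)"
    using C2N_norm_bounded[of "\<Sum>n\<in>F. a n *\<^sub>R E n" x] by simp
qed

text \<open>At any point only the accepted indices contribute, and they form a chain. Together with
  \<open>norm_chain_le\<close> this computes the norm as a maximum over chains.\<close>

lemma norm_le_chains:
  assumes "finite F" "\<And>C. C \<subseteq> F \<Longrightarrow> chain C \<Longrightarrow> norm (\<Sum>n\<in>C. a n *\<^sub>R D n) \<le> b"
  shows "norm (\<Sum>n\<in>F. a n *\<^sub>R E n) \<le> b"
proof (rule C2N_norm_bound)
  fix x
  let ?C = "F \<inter> accepted cmp x" and ?t = "\<lambda>i. x (2 * i + 1)"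
  have "(\<Sum>n\<in>F. a n *\<^sub>R E n) x = (\<Sum>n\<in>F. if n \<in> accepted cmp x then a n * D n ?t else 0)"
    by (auto simp: amalgam_apply intro!: sum.cong)
  also have "\<dots> = (\<Sum>n\<in>?C. a n *\<^sub>R D n) ?t"
    using assms(1) by (simp add: sum.inter_restrict[symmetric])
  also have "\<bar>\<dots>\<bar> \<le> norm (\<Sum>n\<in>?C. a n *\<^sub>R D n)" by (rule C2N_norm_bounded)
  also have "\<dots> \<le> b"
    by (rule assms(2)) (auto intro: chain_subset[OF chain_accepted])
  finally show "\<bar>(\<Sum>n\<in>F. a n *\<^sub>R E n) x\<bar> \<le> b" .
qed

text \<open>A chain inside G is also a chain inside F, hence the constant 1.\<close>

lemma suppression_E: "suppression 1 E"
  unfolding suppression_def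
proof (intro allI impI)
  fix F G :: "nat set" and a assume F: "finite F" "G \<subseteq> F"
  show "norm (\<Sum>i\<in>G. a i *\<^sub>R E i) \<le> 1 * norm (\<Sum>i\<in>F. a i *\<^sub>R E i)"
    using F by (auto intro!: norm_le_chains norm_chain_le intro: finite_subset)
qed

lemma E_nonzero: "E n \<noteq> 0"
  using norm_chain_le[of "{n}" "{n}" "\<lambda>_. 1"] D_nonzero[of n] cmp_refl
  by (auto simp: chain_def)

definition Y :: "C2N set" where "Y = closure (span (range E))"

lemma Y_SB: "Y \<in> SB"
  by (simp add: SB_def Y_def closed_closure subspace_closure_real)

lemma Y_unconditional: "has_unconditional_basis Y"
  unfolding has_unconditional_basis_def Y_def
  using suppression_unconditional_basis[OF suppression_E E_nonzero] by blast

end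

section \<open>Pointwise null sequences and the absence of l1 in the amalgam\<close>

text \<open>Each block starts where the previous one ended, at some M. A late n makes the terms
  before M sum to less than \<epsilon>/4, a far end point cuts off a tail below \<epsilon>/4, and at
  least \<epsilon>/2 of the value \<open>s n\<close> stays in between.\<close>

lemma gliding_hump:
  fixes f :: "nat \<Rightarrow> nat \<Rightarrow> real"
  assumes sums: "\<And>n. f n sums s n" and coord: "\<And>k. (\<lambda>n. f n k) \<longlonglongrightarrow> 0"
    and notnull: "\<not> s \<longlonglongrightarrow> 0"
  obtains \<eta> \<nu> I where "\<eta> > 0" "disjoint_family (I :: nat \<Rightarrow> nat set)" "\<And>j. finite (I j)"
    "\<And>j. \<bar>\<Sum>k\<in>I j. f (\<nu> j) k\<bar> \<ge> \<eta>"
proof -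
  obtain \<epsilon> where \<epsilon>: "\<epsilon> > 0" "\<And>N. \<exists>n\<ge>N. \<bar>s n\<bar> \<ge> \<epsilon>"
    using notnull unfolding LIMSEQ_iff by (auto simp: not_less)
  have step: "\<exists>n M'. M' \<ge> M \<and> \<bar>\<Sum>k\<in>{M..<M'}. f n k\<bar> \<ge> \<epsilon>/2" for M
  proof -
    have "(\<lambda>n. \<Sum>k<M. f n k) \<longlonglongrightarrow> (\<Sum>k<M. 0)"
      by (intro tendsto_sum coord)
    then obtain N where N: "\<And>n. n \<ge> N \<Longrightarrow> \<bar>\<Sum>k<M. f n k\<bar> < \<epsilon>/4"
      using LIMSEQ_D[of _ 0 "\<epsilon>/4"] \<epsilon>(1) by fastforce
    obtain n where n: "n \<ge> N" "\<bar>s n\<bar> \<ge> \<epsilon>" using \<epsilon>(2) by blast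
    have "\<exists>N'. \<forall>m\<ge>N'. \<bar>(\<Sum>k<m. f n k) - s n\<bar> < \<epsilon>/4"
      using LIMSEQ_D[OF sums[of n, unfolded sums_def], of "\<epsilon>/4"] \<epsilon>(1) by simp
    then obtain N' where N': "\<And>m. m \<ge> N' \<Longrightarrow> \<bar>(\<Sum>k<m. f n k) - s n\<bar> < \<epsilon>/4" by blast
    let ?M = "max M N'"
    have "(\<Sum>k<?M. f n k) = (\<Sum>k<M. f n k) + (\<Sum>k\<in>{M..<?M}. f n k)"
      by (subst sum.union_disjoint[symmetric]) (auto intro!: sum.cong)
    then have "\<bar>\<Sum>k\<in>{M..<?M}. f n k\<bar> \<ge> \<epsilon>/2"
      using N[OF n(1)] N'[of ?M] n(2) by linarith
    then show ?thesis by (intro exI[of _ n] exI[of _ ?M]) auto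
  qed
  then obtain \<mu> \<nu> where \<mu>: "\<And>M. \<mu> M \<ge> (M::nat)"
    "\<And>M. \<bar>\<Sum>k\<in>{M..<\<mu> M}. f (\<nu> M) k\<bar> \<ge> \<epsilon>/2" by metis
  define M where "M = rec_nat 0 (\<lambda>_. \<mu>)"
  have MS: "M (Suc j) = \<mu> (M j)" for j by (simp add: M_def)
  have mono: "mono M" unfolding mono_iff_le_Suc using \<mu>(1) MS by simp
  show ?thesis
  proof (rule that[of "\<epsilon>/2" "\<lambda>j. {M j..<M (Suc j)}" "\<lambda>j. \<nu> (M j)"])
    show "disjoint_family (\<lambda>j. {M j..<M (Suc j)})"
      unfolding disjoint_family_on_def
    proof (intro ballI impI)
      fix i j :: nat assume "i \<noteq> j"
      then have "M (Suc i) \<le> M j \<or> M (Suc j) \<le> M i"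
        using monoD[OF mono, of "Suc i" j] monoD[OF mono, of "Suc j" i] by linarith
      then show "{M i..<M (Suc i)} \<inter> {M j..<M (Suc j)} = {}" by auto
    qed
    show "\<bar>\<Sum>k\<in>{M j..<M (Suc j)}. f (\<nu> (M j)) k\<bar> \<ge> \<epsilon>/2" for j
      unfolding MS by (rule \<mu>(2))
  qed (use \<epsilon>(1) in auto)
qed

lemma diagonal_convergent:
  fixes f :: "nat \<Rightarrow> nat \<Rightarrow> real"
  assumes "\<And>n k. \<bar>f n k\<bar> \<le> B k"
  obtains r where "strict_mono (r :: nat \<Rightarrow> nat)" "\<And>k. convergent (\<lambda>n. f (r n) k)"
proof -
  interpret subseqs "\<lambda>k s. convergent (\<lambda>n. f (s n) k)"
  proof
    fix k and s :: "nat \<Rightarrow> nat" assume "strict_mono s"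
    have "\<forall>n. f (s n) k \<in> {- B k..B k}"
      using assms[of _ k] by (auto simp: abs_le_iff) (smt (verit) assms)
    then obtain l r where "strict_mono r" "((\<lambda>n. f (s n) k) \<circ> r) \<longlonglongrightarrow> l"
      using compact_Icc[of "- B k" "B k"] unfolding compact_def by meson
    then show "\<exists>r. strict_mono r \<and> convergent (\<lambda>n. f ((s \<circ> r) n) k)"
      by (auto simp: convergent_def o_def)
  qed
  have "convergent (\<lambda>n. f (diagseq n) k)" for k
  proof -
    have "convergent (\<lambda>n. f ((diagseq \<circ> (+) (Suc k)) n) k)"
    proof (rule diagseq_holds)
      fix r s :: "nat \<Rightarrow> nat" and n
      assume "strict_mono r" "convergent (\<lambda>m. f (s m) n)"
      then show "convergent (\<lambda>m. f ((s \<circ> r) m) n)"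
        using convergent_subseq_convergent[of "\<lambda>m. f (s m) n" r] by (simp add: o_def)
    qed
    then have "convergent (\<lambda>n. f (diagseq (n + Suc k)) k)"
      by (simp add: add.commute)
    then show ?thesis by (rule convergent_ignore_initial_segment[THEN iffD1])
  qed
  then show ?thesis using subseq_diagseq that by blast
qed


context amalgamation
begin

text \<open>Hypothesis \<open>P\<close> is the absence of l1 on branches in the form needed here: on
  an unconditional branch, disjoint blocks that are bounded together with their subsums and stay
  above a fixed positive value at one point would generate l1. The gliding hump at x supplies such
  blocks on the chain accepted by x.\<close>

lemma pointwise_null:
  fixes y :: "nat \<Rightarrow> C2N"
  assumes P: "\<And>C t I b B \<eta>. infinite C \<Longrightarrow> chain C \<Longrightarrow> \<eta> > 0 \<Longrightarrow> disjoint_family (I :: nat \<Rightarrow> nat set) \<Longrightarrow>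
      (\<And>j. finite (I j)) \<Longrightarrow> (\<And>j. I j \<subseteq> C) \<Longrightarrow>
      (\<And>j J. J \<subseteq> I j \<Longrightarrow> norm (\<Sum>n\<in>J. b j n *\<^sub>R D n) \<le> B) \<Longrightarrow>
      (\<And>j. (\<Sum>n\<in>I j. b j n *\<^sub>R D n) t \<ge> \<eta>) \<Longrightarrow> False"
    and y: "\<And>n. y n \<in> Y" "\<And>n. norm (y n) \<le> B"
    and coord: "\<And>k. (\<lambda>n. coords E (y n) k) \<longlonglongrightarrow> 0"
  shows "(\<lambda>n. y n x) \<longlonglongrightarrow> 0"
proof (rule ccontr)
  assume notnull: "\<not> (\<lambda>n. y n x) \<longlonglongrightarrow> 0"
  let ?C = "accepted cmp x" and ?t = "\<lambda>i. x (2 * i + 1)"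
  have ysum: "(\<lambda>k. coords E (y n) k *\<^sub>R E k) sums y n" for n
    using coords_sums[OF suppression_E E_nonzero] y(1) unfolding Y_def by blast
  have a1: "(\<lambda>k. coords E (y n) k * E k x) sums y n x" for n
    using bounded_linear.sums[OF bounded_linear_C2N_apply[of x] ysum[of n]] by simp
  have a2: "(\<lambda>n. coords E (y n) k * E k x) \<longlonglongrightarrow> 0" for k
    using tendsto_mult_left_zero[OF coord] by blast
  obtain \<eta> \<nu> I where \<eta>: "\<eta> > 0" and I: "disjoint_family (I :: nat \<Rightarrow> nat set)" "\<And>j. finite (I j)"
    and big: "\<And>j. \<bar>\<Sum>k\<in>I j. coords E (y (\<nu> j)) k * E k x\<bar> \<ge> \<eta>"
    by (rule gliding_hump[where f = "\<lambda>n k. coords E (y n) k * E k x" and s = "\<lambda>n. y n x", OF a1 a2 notnull])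
      (rule that; assumption)
  define I' where "I' j = I j \<inter> ?C" for j
  define S where "S j = (\<Sum>k\<in>I' j. coords E (y (\<nu> j)) k * D k ?t)" for j
  \<comment> \<open>The signs turn a lower bound for absolute values into the one-sided bound that
    \<open>P\<close> refutes.\<close>
  define b where "b j k = sgn (S j) * coords E (y (\<nu> j)) k" for j k
  have "(\<Sum>k\<in>I j. coords E (y (\<nu> j)) k * E k x) =
      (\<Sum>k\<in>I j. if k \<in> ?C then coords E (y (\<nu> j)) k * D k ?t else 0)" for j
    by (intro sum.cong) (auto simp: amalgam_apply)
  then have SI: "(\<Sum>k\<in>I j. coords E (y (\<nu> j)) k * E k x) = S j" for j
    using I(2) by (simp add: S_def I'_def sum.inter_restrict[symmetric])
  have bS: "(\<Sum>k\<in>I' j. b j k *\<^sub>R D k) ?t = \<bar>S j\<bar>" for j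
  proof -
    have "(\<Sum>k\<in>I' j. b j k *\<^sub>R D k) ?t = sgn (S j) * (\<Sum>k\<in>I' j. coords E (y (\<nu> j)) k * D k ?t)"
      by (simp add: b_def sum_distrib_left mult.assoc)
    also have "\<dots> = sgn (S j) * S j" by (simp add: S_def)
    also have "\<dots> = \<bar>S j\<bar>" by (simp add: sgn_if)
    finally show ?thesis .
  qed
  have ne: "I' j \<noteq> {}" for j
    using big[of j] \<eta> unfolding SI S_def by auto
  have disj: "disjoint_family I'"
    using I(1) by (auto simp: disjoint_family_on_def I'_def)
  \<comment> \<open>Infinitely many pairwise disjoint nonempty blocks do not fit into a finite
    chain.\<close>
  have "infinite ?C"
  proof
    assume "finite ?C"
    moreover have "\<Union> (range I') \<subseteq> ?C" by (auto simp: I'_def)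
    ultimately have "finite (\<Union> (range I'))" by (rule rev_finite_subset)
    then have "finite (range I')" by (rule finite_UnionD)
    moreover have "inj I'"
      using disj ne by (intro injI) (metis Int_absorb disjoint_family_onD UNIV_I)
    ultimately show False using finite_imageD infinite_UNIV_nat by blast
  qed
  moreover have "norm (\<Sum>n\<in>J. b j n *\<^sub>R D n) \<le> B" if "J \<subseteq> I' j" for j J
  proof -
    have fJ: "finite J" using that I(2)[of j] by (auto simp: I'_def intro: finite_subset)
    have "chain J" using that chain_subset[OF chain_accepted] by (auto simp: I'_def)
    then have "norm (\<Sum>n\<in>J. b j n *\<^sub>R D n) \<le> norm (\<Sum>n\<in>J. b j n *\<^sub>R E n)"
      using fJ by (intro norm_chain_le) auto
    also have "(\<Sum>n\<in>J. b j n *\<^sub>R E n) = sgn (S j) *\<^sub>R (\<Sum>n\<in>J. coords E (y (\<nu> j)) n *\<^sub>R E n)"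
      by (simp add: b_def scaleR_sum_right)
    also have "norm \<dots> \<le> norm (\<Sum>n\<in>J. coords E (y (\<nu> j)) n *\<^sub>R E n)"
      by (simp add: mult_left_le_one_le abs_sgn_eq)
    also have "\<dots> \<le> 1 * norm (y (\<nu> j))"
      by (rule suppression_sums_le[OF suppression_E ysum fJ])
    finally show ?thesis using y(2)[of "\<nu> j"] by simp
  qed
  moreover have "(\<Sum>n\<in>I' j. b j n *\<^sub>R D n) ?t \<ge> \<eta>" for j
    unfolding bS using big[of j] SI by simp
  moreover have "finite (I' j)" "I' j \<subseteq> ?C" for j using I(2) by (auto simp: I'_def)
  ultimately show False
    using P[of ?C \<eta> I' b B ?t] chain_accepted \<eta> disj by blast
qed

theorem Y_no_l1:
  assumes P: "\<And>C t I b B \<eta>. infinite C \<Longrightarrow> chain C \<Longrightarrow> \<eta> > 0 \<Longrightarrow> disjoint_family (I :: nat \<Rightarrow> nat set) \<Longrightarrow>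
      (\<And>j. finite (I j)) \<Longrightarrow> (\<And>j. I j \<subseteq> C) \<Longrightarrow>
      (\<And>j J. J \<subseteq> I j \<Longrightarrow> norm (\<Sum>n\<in>J. b j n *\<^sub>R D n) \<le> B) \<Longrightarrow>
      (\<And>j. (\<Sum>n\<in>I j. b j n *\<^sub>R D n) t \<ge> \<eta>) \<Longrightarrow> False"
  shows "\<not> contains_l1 Y"
proof
  assume "contains_l1 Y"
  then obtain T c K where TY: "\<And>a. a \<in> l1 \<Longrightarrow> T a \<in> Y"
    and Tlin: "\<And>a b s t. a \<in> l1 \<Longrightarrow> b \<in> l1 \<Longrightarrow> T (\<lambda>n. s * a n + t * b n) = s *\<^sub>R T a + t *\<^sub>R T b"
    and c: "c > 0" and Tlow: "\<And>a. a \<in> l1 \<Longrightarrow> c * l1_norm a \<le> norm (T a)"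
    and Tup: "\<And>a. a \<in> l1 \<Longrightarrow> norm (T a) \<le> K * l1_norm a"
    unfolding contains_l1_def by blast
  define \<delta> where "\<delta> n = (\<lambda>i. if i = n then 1 else 0 :: real)" for n :: nat
  have \<delta>s: "(\<lambda>i. \<bar>\<delta> n i\<bar>) sums 1" for n
  proof -
    have "(\<lambda>i. \<bar>\<delta> n i\<bar>) = (\<lambda>i. if i = n then 1 else 0)" by (auto simp: \<delta>_def)
    then show ?thesis using sums_single[of n "\<lambda>_. 1"] by simp
  qed
  have \<delta>l1: "\<delta> n \<in> l1" and \<delta>n: "l1_norm (\<delta> n) = 1" for n
    using \<delta>s[of n] by (auto simp: l1_def l1_norm_def sums_iff)
  have l1_lin: "(\<lambda>n. s * a n + t * b n) \<in> l1" if "a \<in> l1" "b \<in> l1" for a b s t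
  proof -
    have "summable (\<lambda>n. \<bar>s\<bar> * \<bar>a n\<bar> + \<bar>t\<bar> * \<bar>b n\<bar>)"
      using that by (intro summable_add summable_mult) (auto simp: l1_def)
    then show ?thesis unfolding l1_def mem_Collect_eq
    proof (rule summable_comparison_test'[where N = 0])
      show "norm \<bar>s * a n + t * b n\<bar> \<le> \<bar>s\<bar> * \<bar>a n\<bar> + \<bar>t\<bar> * \<bar>b n\<bar>" for n
        using abs_triangle_ineq[of "s * a n" "t * b n"] by (simp add: abs_mult)
    qed
  qed
  define u where "u n = T (\<delta> n)" for n
  have uY: "u n \<in> Y" and uK: "norm (u n) \<le> K" for n
    using TY[OF \<delta>l1] Tup[OF \<delta>l1[of n]] \<delta>n by (auto simp: u_def)
  have cle: "\<bar>coords E (u n) k\<bar> \<le> K / norm (E k)" for n k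
  proof -
    have "norm (\<Sum>i\<in>{k}. coords E (u n) i *\<^sub>R E i) \<le> 1 * norm (u n)"
      by (rule suppression_sums_le[OF suppression_E coords_sums[OF suppression_E E_nonzero]])
         (use uY in \<open>auto simp: Y_def\<close>)
    then show ?thesis using uK[of n] E_nonzero[of k] by (simp add: field_simps)
  qed
  obtain r where r: "strict_mono (r :: nat \<Rightarrow> nat)" "\<And>k. convergent (\<lambda>n. coords E (u (r n)) k)"
    using diagonal_convergent[of "\<lambda>n k. coords E (u n) k", OF cle] by blast
  \<comment> \<open>Along r the coordinates converge, so those of differences of neighbouring terms
    tend to 0, as \<open>pointwise_null\<close> requires.\<close>
  define y where "y n = u (r (2 * n)) - u (r (2 * n + 1))" for n
  have yT: "y n = T (\<lambda>i. 1 * \<delta> (r (2 * n)) i + (-1) * \<delta> (r (2 * n + 1)) i)" for n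
    unfolding y_def u_def by (subst Tlin) (auto simp: \<delta>l1)
  have ycoords: "coords E (y n) k = coords E (u (r (2 * n))) k - coords E (u (r (2 * n + 1))) k" for n k
    using coords_linear[OF suppression_E E_nonzero, of "u (r (2 * n))" "u (r (2 * n + 1))" 1 "-1" k] uY
    by (simp add: y_def Y_def)
  have ylim: "(\<lambda>n. coords E (y n) k) \<longlonglongrightarrow> 0" for k
  proof -
    obtain l where l: "(\<lambda>n. coords E (u (r n)) k) \<longlonglongrightarrow> l"
      using r(2) by (auto simp: convergent_def)
    have "((\<lambda>n. coords E (u (r n)) k) \<circ> (\<lambda>n. 2 * n)) \<longlonglongrightarrow> l"
      by (rule LIMSEQ_subseq_LIMSEQ[OF l]) (simp add: strict_mono_def)
    moreover have "((\<lambda>n. coords E (u (r n)) k) \<circ> (\<lambda>n. 2 * n + 1)) \<longlonglongrightarrow> l"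
      by (rule LIMSEQ_subseq_LIMSEQ[OF l]) (simp add: strict_mono_def)
    ultimately show ?thesis
      unfolding ycoords o_def using tendsto_diff by fastforce
  qed
  have yB: "norm (y n) \<le> 2 * K" for n
    using norm_triangle_ineq4[of "u (r (2 * n))" "u (r (2 * n + 1))"] uK[of "r (2 * n)"] uK[of "r (2 * n + 1)"]
    by (simp add: y_def)
  have yY: "y n \<in> Y" for n
    unfolding yT by (rule TY) (rule l1_lin[OF \<delta>l1 \<delta>l1])
  have "(\<lambda>n. y n x) \<longlonglongrightarrow> 0" for x
    by (rule pointwise_null[OF _ yY yB ylim]) (rule P)
  moreover have "\<exists>x. \<not> (\<lambda>n. y n x) \<longlonglongrightarrow> 0"
  proof (rule Simons_convex_lower_bound)
    show "norm (y n) \<le> 2 * K" for n by (rule yB)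
    show "2 * c > 0" using c by simp
    fix h assume h: "h \<in> convex hull (range y)"
    \<comment> \<open>The functional with coefficients s has norm at most 1 on l1 and takes the
      value 2 on the preimage of every \<open>y n\<close>, hence on suitable preimages of the whole
      convex hull, which Q records. Such preimages have l1 norm at least 2, which yields the bound
      \<open>2 * c\<close>.\<close>
    define s where "s k = (if k \<in> range (\<lambda>n. r (2 * n)) then 1
        else if k \<in> range (\<lambda>n. r (2 * n + 1)) then - 1 else 0 :: real)" for k
    define Q where "Q = {T a |a. a \<in> l1 \<and> (\<lambda>k. s k * a k) sums 2}"
    have "convex hull (range y) \<subseteq> Q"
    proof (rule hull_minimal)
      show "range y \<subseteq> Q"
      proof clarify
        fix n
        let ?a = "\<lambda>i. 1 * \<delta> (r (2 * n)) i + (-1) * \<delta> (r (2 * n + 1)) i"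
        have eq: "r i = r j \<longleftrightarrow> i = j" for i j using r(1) by (simp add: strict_mono_eq)
        have s1: "s (r (2 * n)) = 1" by (simp add: s_def)
        have s2: "s (r (2 * n + 1)) = -1"
          unfolding s_def image_iff eq by (auto, presburger)
        have "(\<lambda>k. s k * ?a k) = (\<lambda>k. (if k = r (2 * n) then 1 else 0) + (if k = r (2 * n + 1) then 1 else 0))"
          using s1 s2 eq[of "2 * n" "2 * n + 1"] by (auto simp: \<delta>_def fun_eq_iff)
        moreover have "\<dots> sums (1 + 1)"
          by (intro sums_add sums_single)
        ultimately have "(\<lambda>k. s k * ?a k) sums 2" by simp
        then show "y n \<in> Q"
          unfolding Q_def yT mem_Collect_eq by (intro exI[of _ ?a] conjI refl l1_lin \<delta>l1)
      qed
      show "convex Q"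
      proof (rule convexI)
        fix f g :: C2N and p q :: real
        assume fg: "f \<in> Q" "g \<in> Q" and pq: "0 \<le> p" "0 \<le> q" "p + q = 1"
        then obtain a b where a: "a \<in> l1" "f = T a" "(\<lambda>k. s k * a k) sums 2"
          and b: "b \<in> l1" "g = T b" "(\<lambda>k. s k * b k) sums 2"
          by (auto simp: Q_def)
        have "(\<lambda>k. s k * (p * a k + q * b k)) sums (p * 2 + q * 2)"
          using sums_add[OF sums_mult[OF a(3), of p] sums_mult[OF b(3), of q]]
          by (simp add: algebra_simps)
        moreover have "p * 2 + q * 2 = 2" using pq by simp
        ultimately have "(\<lambda>k. s k * (p * a k + q * b k)) sums 2" by simp
        moreover have "p *\<^sub>R f + q *\<^sub>R g = T (\<lambda>k. p * a k + q * b k)"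
          using a b Tlin by simp
        ultimately show "p *\<^sub>R f + q *\<^sub>R g \<in> Q"
          unfolding Q_def using l1_lin[OF a(1) b(1)] by blast
      qed
    qed
    then obtain a where a: "a \<in> l1" "h = T a" "(\<lambda>k. s k * a k) sums 2"
      using h by (auto simp: Q_def)
    have "2 \<le> l1_norm a"
      unfolding l1_norm_def
    proof (rule sums_le[OF _ a(3)])
      show "(\<lambda>n. \<bar>a n\<bar>) sums (\<Sum>n. \<bar>a n\<bar>)"
        using a(1) by (simp add: l1_def summable_sums)
      show "s k * a k \<le> \<bar>a k\<bar>" for k
        by (auto simp: s_def abs_ge_self abs_ge_minus_self)
    qed
    then have "2 * c \<le> c * l1_norm a" using c by simp
    also have "\<dots> \<le> norm h" using Tlow[OF a(1)] a(2) by simp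
    finally show "2 * c \<le> norm h" .
  qed
  ultimately show False by blast
qed

end

section \<open>Suslin sets in the Baire space\<close>

lemma LIMSEQ_baire_unique:
  fixes x :: "nat \<Rightarrow> nat \<Rightarrow> nat"
  assumes "x \<longlonglongrightarrow> a" "x \<longlonglongrightarrow> b"
  shows "a = b"
proof
  fix i
  have "\<forall>\<^sub>F n in sequentially. x n i = a i" "\<forall>\<^sub>F n in sequentially. x n i = b i"
    using assms by (auto simp: tendsto_baire_iff)
  then have "\<forall>\<^sub>F n :: nat in sequentially. a i = b i" by eventually_elim simp
  then show "a i = b i" by simp
qed

lemma closed_baire_approx:
  assumes "closed (C :: (nat \<Rightarrow> nat) set)" "\<And>n. \<exists>\<sigma>'\<in>C. \<forall>i<n. \<sigma>' i = \<sigma> i"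
  shows "\<sigma> \<in> C"
proof -
  obtain s where s: "\<And>n. s n \<in> C" "\<And>n i. i < n \<Longrightarrow> s n i = \<sigma> i" using assms(2) by metis
  have "s \<longlonglongrightarrow> \<sigma>"
    unfolding tendsto_baire_iff eventually_sequentially by (metis Suc_le_eq s(2))
  then show ?thesis using closed_sequentially[OF assms(1)] s(1) by blast
qed

lemma continuous_on_baireI:
  fixes g :: "(nat \<Rightarrow> nat) \<Rightarrow> 'a::topological_space"
  assumes "\<And>x l. (\<And>n. x n \<in> C) \<Longrightarrow> l \<in> C \<Longrightarrow> x \<longlonglongrightarrow> l \<Longrightarrow> (\<lambda>n. g (x n)) \<longlonglongrightarrow> g l"
  shows "continuous_on C g"
  unfolding continuous_on_def tendsto_at_iff_sequentially o_def using assms by simp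

text \<open>Analytic sets, parametrized by closed subsets of the Baire space. Closed domains, unlike
  the full space alone, are directly available for disjoint unions and fibre products, and they
  include the empty set.\<close>

definition suslin :: "'a::topological_space set \<Rightarrow> bool" where
  "suslin S \<longleftrightarrow> (\<exists>(C :: (nat \<Rightarrow> nat) set) g. closed C \<and> continuous_on C g \<and> S = g ` C)"

lemma suslin_closed: "closed S \<Longrightarrow> suslin (S :: (nat \<Rightarrow> nat) set)"
  unfolding suslin_def by (intro exI[of _ S] exI[of _ id]) auto

text \<open>Disjoint union of the parameter sets: the first entry of a parameter selects n, the
  remaining ones form a parameter for \<open>S n\<close>.\<close>

lemma suslin_UN:
  assumes "\<And>n :: nat. suslin (S n)"
  shows "suslin (\<Union>n. S n)"
proof -
  obtain C g where C: "\<And>n. closed (C n :: (nat \<Rightarrow> nat) set)" "\<And>n. continuous_on (C n) (g n)"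
    "\<And>n. S n = g n ` C n"
    using assms unfolding suslin_def by metis
  let ?tl = "\<lambda>\<sigma> i. \<sigma> (Suc i) :: nat"
  define C' where "C' = {\<sigma>. ?tl \<sigma> \<in> C (\<sigma> 0)}"
  define g' where "g' \<sigma> = g (\<sigma> 0) (?tl \<sigma>)" for \<sigma>
  have lim: "\<forall>\<^sub>F n in sequentially. x n 0 = l 0" "(\<lambda>n. ?tl (x n)) \<longlonglongrightarrow> ?tl l" if "x \<longlonglongrightarrow> l" for x l
    using that by (auto simp: tendsto_baire_iff)
  have mem: "l \<in> C' \<and> (\<lambda>n. g' (x n)) \<longlonglongrightarrow> g' l" if x: "\<And>n. x n \<in> C'" "x \<longlonglongrightarrow> l" for x l
  proof -
    obtain N where N: "\<And>n. n \<ge> N \<Longrightarrow> x n 0 = l 0"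
      using lim(1)[OF x(2)] by (auto simp: eventually_sequentially)
    let ?z = "\<lambda>n. ?tl (x (n + N))"
    have z: "?z n \<in> C (l 0)" for n using x(1)[of "n + N"] N[of "n + N"] by (simp add: C'_def)
    have zl: "?z \<longlonglongrightarrow> ?tl l" using LIMSEQ_ignore_initial_segment[OF lim(2)[OF x(2)]] .
    have lC: "?tl l \<in> C (l 0)" using closed_sequentially[OF C(1) z zl] .
    have "(\<lambda>n. g (l 0) (?z n)) \<longlonglongrightarrow> g (l 0) (?tl l)"
      using continuous_on_tendsto_compose[OF C(2) zl lC] z by simp
    then have "(\<lambda>n. g' (x (n + N))) \<longlonglongrightarrow> g' l"
      using N by (simp add: g'_def)
    then show ?thesis using lC LIMSEQ_offset by (auto simp: C'_def)
  qed
  have "closed C'"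
    unfolding closed_sequential_limits using mem by blast
  moreover have "continuous_on C' g'"
    by (rule continuous_on_baireI) (use mem in blast)
  moreover have "(\<Union>n. S n) = g' ` C'"
  proof
    show "(\<Union>n. S n) \<subseteq> g' ` C'"
    proof
      fix y assume "y \<in> (\<Union>n. S n)"
      then obtain n \<sigma> where "\<sigma> \<in> C n" "y = g n \<sigma>" using C(3) by auto
      then show "y \<in> g' ` C'"
        by (intro image_eqI[of _ _ "case_nat n \<sigma>"]) (auto simp: C'_def g'_def)
    qed
    show "g' ` C' \<subseteq> (\<Union>n. S n)" using C(3) by (auto simp: C'_def g'_def)
  qed
  ultimately show ?thesis unfolding suslin_def by blast
qed

text \<open>Fibre product of the parameter sets: one sequence codes a parameter for every
  \<open>S n\<close>, all with the same image, and this condition is closed because limits are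
  unique.\<close>

lemma suslin_INT:
  fixes S :: "nat \<Rightarrow> (nat \<Rightarrow> nat) set"
  assumes "\<And>n :: nat. suslin (S n)"
  shows "suslin (\<Inter>n. S n)"
proof -
  obtain C g where C: "\<And>n. closed (C n :: (nat \<Rightarrow> nat) set)" "\<And>n. continuous_on (C n) (g n)"
    "\<And>n. S n = g n ` C n"
    using assms unfolding suslin_def by metis
  let ?s = "\<lambda>n \<sigma> i. \<sigma> (prod_encode (n, i)) :: nat"
  define C' where "C' = {\<sigma>. \<forall>n. ?s n \<sigma> \<in> C n \<and> g n (?s n \<sigma>) = g 0 (?s 0 \<sigma>)}"
  define g' where "g' \<sigma> = g 0 (?s 0 \<sigma>)" for \<sigma>
  have lim: "(\<lambda>n. ?s k (x n)) \<longlonglongrightarrow> ?s k l" if "x \<longlonglongrightarrow> l" for x l k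
    using that by (auto simp: tendsto_baire_iff)
  have mem: "l \<in> C' \<and> (\<lambda>n. g' (x n)) \<longlonglongrightarrow> g' l" if x: "\<And>n. x n \<in> C'" "x \<longlonglongrightarrow> l" for x l
  proof -
    have z: "?s k (x n) \<in> C k" for n k using x(1)[of n] by (simp add: C'_def)
    have lC: "?s k l \<in> C k" for k using closed_sequentially[OF C(1) z lim[OF x(2)]] .
    have g: "(\<lambda>n. g k (?s k (x n))) \<longlonglongrightarrow> g k (?s k l)" for k
      using continuous_on_tendsto_compose[OF C(2) lim[OF x(2)] lC] z by simp
    have "(\<lambda>n. g k (?s k (x n))) = (\<lambda>n. g 0 (?s 0 (x n)))" for k
      using x(1) by (auto simp: C'_def)
    then have "g k (?s k l) = g 0 (?s 0 l)" for k
      using g[of k] g[of 0] LIMSEQ_baire_unique by metis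
    then show ?thesis using lC g[of 0] by (auto simp: C'_def g'_def)
  qed
  have "closed C'"
    unfolding closed_sequential_limits using mem by blast
  moreover have "continuous_on C' g'"
    by (rule continuous_on_baireI) (use mem in blast)
  moreover have "(\<Inter>n. S n) = g' ` C'"
  proof
    show "(\<Inter>n. S n) \<subseteq> g' ` C'"
    proof
      fix y assume "y \<in> (\<Inter>n. S n)"
      then have "\<forall>n. \<exists>\<sigma>. \<sigma> \<in> C n \<and> y = g n \<sigma>" using C(3) by auto
      then obtain \<sigma> where \<sigma>: "\<And>n. \<sigma> n \<in> C n" "\<And>n. y = g n (\<sigma> n)" by metis
      let ?\<tau> = "\<lambda>k. \<sigma> (fst (prod_decode k)) (snd (prod_decode k))"
      have "?s n ?\<tau> = \<sigma> n" for n by simp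
      then show "y \<in> g' ` C'"
        using \<sigma> by (intro image_eqI[of _ _ ?\<tau>]) (auto simp: C'_def g'_def)
    qed
    show "g' ` C' \<subseteq> (\<Inter>n. S n)"
    proof
      fix y assume "y \<in> g' ` C'"
      then obtain \<sigma> where \<sigma>: "\<sigma> \<in> C'" "y = g' \<sigma>" by blast
      then have "y = g n (?s n \<sigma>)" "?s n \<sigma> \<in> C n" for n
        unfolding C'_def g'_def by (metis (mono_tags, lifting) mem_Collect_eq)+
      then show "y \<in> (\<Inter>n. S n)" using C(3) by blast
    qed
  qed
  ultimately show ?thesis unfolding suslin_def by blast
qed

text \<open>An open set is a countable union of cylinders, and cylinders are closed.\<close>

lemma suslin_open:
  assumes "open (U :: (nat \<Rightarrow> nat) set)"
  shows "suslin U"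
proof -
  define cyl where "cyl s = {\<sigma> :: nat \<Rightarrow> nat. \<forall>i<length s. \<sigma> i = s ! i}" for s
  define S where "S n = (if cyl (from_nat n) \<subseteq> U then cyl (from_nat n) else {})" for n
  have "closed (cyl s)" for s
    unfolding closed_sequential_limits cyl_def
    by (auto simp: tendsto_baire_iff eventually_sequentially) (metis order_refl)
  then have "suslin (S n)" for n by (simp add: S_def suslin_closed)
  moreover have "U = (\<Union>n. S n)"
  proof
    show "U \<subseteq> (\<Union>n. S n)"
    proof
      fix x assume "x \<in> U"
      then obtain n where n: "\<And>y. \<forall>i<n. y i = x i \<Longrightarrow> y \<in> U"
        using closed_baire_approx[of "- U" x] assms by auto
      then have "cyl (map x [0..<n]) \<subseteq> U" by (auto simp: cyl_def)
      moreover have "x \<in> cyl (map x [0..<n])" by (simp add: cyl_def)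
      ultimately have "x \<in> S (to_nat (map x [0..<n]))" by (simp add: S_def)
      then show "x \<in> (\<Union>n. S n)" by blast
    qed
  qed (auto simp: S_def)
  ultimately show ?thesis using suslin_UN by metis
qed

text \<open>The induction runs over sets that are suslin together with their complements, since
  suslin sets alone are not closed under complementation.\<close>

lemma suslin_borel:
  assumes "S \<in> sets (borel :: (nat \<Rightarrow> nat) measure)"
  shows "suslin S"
proof -
  have "S \<in> sigma_sets UNIV {S. open S}" using assms by (simp add: borel_def)
  then have "suslin S \<and> suslin (- S)"
  proof induction
    case (Basic a)
    then show ?case by (auto simp: suslin_open intro!: suslin_closed)
  next
    case Empty
    then show ?case by (simp add: suslin_closed)
  next
    case (Compl a)
    then show ?case by (simp add: Compl_eq_Diff_UNIV[symmetric])
  next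
    case (Union a)
    have "suslin (\<Union>i. a i)" by (rule suslin_UN) (use Union in blast)
    moreover have "suslin (\<Inter>i. - a i)" by (rule suslin_INT) (use Union in blast)
    ultimately show ?case by simp
  qed
  then show ?thesis ..
qed

text \<open>G is the graph of a parametrization of W, with argument and value paired coordinatewise.
  A Borel condition on w thus becomes a closed condition on w together with a witness, which is what
  a tree can express.\<close>

lemma borel_projection_of_closed:
  assumes "W \<in> sets (borel :: (nat \<Rightarrow> nat) measure)"
  obtains G where "closed G" "W = (\<lambda>\<sigma> k. fst (prod_decode (\<sigma> k))) ` G"
proof -
  obtain C and g :: "(nat \<Rightarrow> nat) \<Rightarrow> nat \<Rightarrow> nat" where C: "closed C" "continuous_on C g" "W = g ` C"
    using suslin_borel[OF assms] unfolding suslin_def by blast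
  let ?f = "\<lambda>\<sigma> k. fst (prod_decode (\<sigma> k)) :: nat" and ?s = "\<lambda>\<sigma> k. snd (prod_decode (\<sigma> k)) :: nat"
  define G where "G = {\<sigma>. ?s \<sigma> \<in> C \<and> g (?s \<sigma>) = ?f \<sigma>}"
  have "closed G"
    unfolding closed_sequential_limits
  proof (intro allI impI, elim conjE)
    fix x l assume x: "\<forall>n. x n \<in> G" and l: "x \<longlonglongrightarrow> l"
    have ev: "\<forall>\<^sub>F n in sequentially. x n i = l i" for i
      using l by (simp add: tendsto_baire_iff)
    have f: "(\<lambda>n. ?f (x n)) \<longlonglongrightarrow> ?f l"
      unfolding tendsto_baire_iff
    proof
      show "\<forall>\<^sub>F n in sequentially. ?f (x n) i = ?f l i" for i
        using ev[of i] by eventually_elim simp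
    qed
    have s: "(\<lambda>n. ?s (x n)) \<longlonglongrightarrow> ?s l"
      unfolding tendsto_baire_iff
    proof
      show "\<forall>\<^sub>F n in sequentially. ?s (x n) i = ?s l i" for i
        using ev[of i] by eventually_elim simp
    qed
    have xC: "?s (x n) \<in> C" "g (?s (x n)) = ?f (x n)" for n using x by (auto simp: G_def)
    have lC: "?s l \<in> C" using closed_sequentially[OF C(1) xC(1) s] .
    have "(\<lambda>n. g (?s (x n))) \<longlonglongrightarrow> g (?s l)"
      using continuous_on_tendsto_compose[OF C(2) s lC] xC(1) by simp
    then have "g (?s l) = ?f l" using f xC(2) LIMSEQ_baire_unique by simp
    then show "l \<in> G" using lC by (simp add: G_def)
  qed
  moreover have "W = ?f ` G"
  proof
    show "W \<subseteq> ?f ` G"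
    proof
      fix w assume "w \<in> W"
      then obtain c where "c \<in> C" "w = g c" using C(3) by blast
      then show "w \<in> ?f ` G"
        by (intro image_eqI[of _ _ "\<lambda>k. prod_encode (w k, c k)"]) (auto simp: G_def)
    qed
    show "?f ` G \<subseteq> W" using C(3) by (auto simp: G_def) (metis imageI)
  qed
  ultimately show ?thesis using that by blast
qed

section \<open>Perturbations and the tree of bases\<close>

text \<open>Sending \<open>e n\<close> to \<open>E n\<close>, the upper estimate makes the image
  series Cauchy, and both estimates pass to the limit.\<close>

lemma equivalent_sequences_copy:
  fixes e :: "nat \<Rightarrow> 'a::banach" and E :: "nat \<Rightarrow> 'b::banach"
  assumes K: "suppression K e" and nz: "\<And>i. e i \<noteq> 0"
    and X: "X \<subseteq> closure (span (range e))" and Y: "subspace Y" "closed Y" "\<And>n. E n \<in> Y"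
    and c: "c > 0" "\<And>F a. finite F \<Longrightarrow> c * norm (\<Sum>n\<in>F. a n *\<^sub>R e n) \<le> norm (\<Sum>n\<in>F. a n *\<^sub>R E n)"
    and L: "\<And>F a. finite F \<Longrightarrow> norm (\<Sum>n\<in>F. a n *\<^sub>R E n) \<le> L * norm (\<Sum>n\<in>F. a n *\<^sub>R e n)"
  shows "contains_copy Y X"
proof -
  have cs: "(\<lambda>n. coords e x n *\<^sub>R e n) sums x" if "x \<in> X" for x
    using coords_sums[OF K nz] X that by blast
  have L0: "0 \<le> L"
  proof -
    have "0 \<le> L * norm (e 0)"
      using L[of "{0}" "\<lambda>_. 1"] by (simp, meson norm_ge_zero order_trans)
    then show ?thesis using nz[of 0] by (simp add: zero_le_mult_iff)
  qed
  have sm: "summable (\<lambda>n. coords e x n *\<^sub>R E n)" if x: "x \<in> X" for x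
    unfolding summable_Cauchy
  proof (intro allI impI)
    fix \<epsilon> :: real assume "\<epsilon> > 0"
    then have "\<epsilon> / (L + 1) > 0" using L0 by simp
    then obtain N where N: "\<And>m n. m \<ge> N \<Longrightarrow> norm (\<Sum>k\<in>{m..<n}. coords e x k *\<^sub>R e k) < \<epsilon> / (L + 1)"
      using sums_summable[OF cs[OF x]] unfolding summable_Cauchy by blast
    have "norm (\<Sum>k\<in>{m..<n}. coords e x k *\<^sub>R E k) < \<epsilon>" if "m \<ge> N" for m n
    proof -
      have "norm (\<Sum>k\<in>{m..<n}. coords e x k *\<^sub>R E k) \<le> L * norm (\<Sum>k\<in>{m..<n}. coords e x k *\<^sub>R e k)"
        by (rule L) simp
      also have "\<dots> \<le> L * (\<epsilon> / (L + 1))"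
        using N[OF that, of n] L0 by (intro mult_left_mono) auto
      also have "\<dots> < \<epsilon>" using L0 \<open>\<epsilon> > 0\<close> by (simp add: field_simps)
      finally show ?thesis .
    qed
    then show "\<exists>N. \<forall>m\<ge>N. \<forall>n. norm (\<Sum>k\<in>{m..<n}. coords e x k *\<^sub>R E k) < \<epsilon>" by blast
  qed
  define T where "T x = (\<Sum>n. coords e x n *\<^sub>R E n)" for x
  have Ts: "(\<lambda>n. coords e x n *\<^sub>R E n) sums T x" if "x \<in> X" for x
    using sm[OF that] by (simp add: T_def summable_sums)
  have "isomorphic_embedding X Y T"
    unfolding isomorphic_embedding_def
  proof (intro conjI ballI)
    show "T x \<in> Y" if "x \<in> X" for x
      using closed_sequentially[OF Y(2) _ Ts[OF that, unfolded sums_def]] Y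
      by (simp add: subspace_sum subspace_scale)
    show "linear_on X T"
      unfolding linear_on_def
    proof (intro ballI allI)
      fix x y and a b :: real assume xy: "x \<in> X" "y \<in> X"
      have "(\<lambda>n. a *\<^sub>R (coords e x n *\<^sub>R E n) + b *\<^sub>R (coords e y n *\<^sub>R E n)) sums (a *\<^sub>R T x + b *\<^sub>R T y)"
        by (intro sums_add sums_scaleR_right Ts xy)
      moreover have "coords e (a *\<^sub>R x + b *\<^sub>R y) n = a * coords e x n + b * coords e y n" for n
        by (rule coords_linear[OF K nz]) (use xy X in auto)
      ultimately have "(\<lambda>n. coords e (a *\<^sub>R x + b *\<^sub>R y) n *\<^sub>R E n) sums (a *\<^sub>R T x + b *\<^sub>R T y)"
        by (simp add: scaleR_left_distrib)
      then show "T (a *\<^sub>R x + b *\<^sub>R y) = a *\<^sub>R T x + b *\<^sub>R T y"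
        by (simp add: T_def sums_iff)
    qed
    have "c * norm x \<le> norm (T x)" "norm (T x) \<le> L * norm x" if "x \<in> X" for x
    proof -
      have e: "(\<lambda>n. norm (\<Sum>k<n. coords e x k *\<^sub>R e k)) \<longlonglongrightarrow> norm x"
        using cs[OF that] unfolding sums_def by (rule tendsto_norm)
      have E: "(\<lambda>n. norm (\<Sum>k<n. coords e x k *\<^sub>R E k)) \<longlonglongrightarrow> norm (T x)"
        using Ts[OF that] unfolding sums_def by (rule tendsto_norm)
      show "c * norm x \<le> norm (T x)"
        by (rule LIMSEQ_le[OF tendsto_mult_left[OF e] E]) (use c in auto)
      show "norm (T x) \<le> L * norm x"
        by (rule LIMSEQ_le[OF E tendsto_mult_left[OF e]]) (use L in auto)
    qed
    then show "\<exists>c>0. \<exists>K. \<forall>x\<in>X. c * norm x \<le> norm (T x) \<and> norm (T x) \<le> K * norm x"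
      using c(1) by blast
  qed
  then show ?thesis by (auto simp: contains_copy_def)
qed

text \<open>Suppression to one index bounds every term of the sum by M times its norm. The weights
  (1/2)^k add up to at most 2, so the factor 1/(4M) keeps the total error within half of that
  norm.\<close>

lemma small_perturbation:
  fixes e d :: "nat \<Rightarrow> 'a::real_normed_vector"
  assumes M: "suppression M e" "M \<ge> 1" and d: "\<And>k. norm (e k - d k) \<le> (1/2)^k / (4 * M) * norm (e k)"
    and F: "finite F"
  shows "norm (\<Sum>k\<in>F. a k *\<^sub>R e k) \<le> 2 * norm (\<Sum>k\<in>F. a k *\<^sub>R d k)"
    and "norm (\<Sum>k\<in>F. a k *\<^sub>R d k) \<le> 2 * norm (\<Sum>k\<in>F. a k *\<^sub>R e k)"
proof -
  let ?e = "\<Sum>k\<in>F. a k *\<^sub>R e k" and ?d = "\<Sum>k\<in>F. a k *\<^sub>R d k"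
  have "norm (?e - ?d) = norm (\<Sum>k\<in>F. a k *\<^sub>R (e k - d k))"
    by (simp add: sum_subtractf scaleR_right_diff_distrib)
  also have "\<dots> \<le> (\<Sum>k\<in>F. (1/2)^k * (norm ?e / 4))"
  proof (rule sum_norm_le)
    fix k assume k: "k \<in> F"
    have "norm (a k *\<^sub>R (e k - d k)) \<le> \<bar>a k\<bar> * ((1/2)^k / (4 * M) * norm (e k))"
      using mult_left_mono[OF d[of k], of "\<bar>a k\<bar>"] by simp
    also have "\<dots> = (1/2)^k / (4 * M) * norm (\<Sum>i\<in>{k}. a i *\<^sub>R e i)" by simp
    also have "\<dots> \<le> (1/2)^k / (4 * M) * (M * norm ?e)"
      using M k F by (intro mult_left_mono suppressionD[OF M(1)]) auto
    also have "\<dots> = (1/2)^k * (norm ?e / 4)" using M(2) by simp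
    finally show "norm (a k *\<^sub>R (e k - d k)) \<le> (1/2)^k * (norm ?e / 4)" .
  qed
  also have "\<dots> = (\<Sum>k\<in>F. (1/2)^k) * (norm ?e / 4)" by (simp add: sum_distrib_right)
  also have "\<dots> \<le> 2 * (norm ?e / 4)"
  proof (rule mult_right_mono)
    have "(\<Sum>k\<in>F. (1/2::real)^k) \<le> (\<Sum>k. (1/2)^k)"
      by (rule sum_le_suminf) (use F in \<open>auto intro: summable_geometric\<close>)
    then show "(\<Sum>k\<in>F. (1/2::real)^k) \<le> 2" by (simp add: suminf_geometric)
  qed simp
  finally have *: "norm (?e - ?d) \<le> norm ?e / 2" by simp
  show "norm ?e \<le> 2 * norm ?d"
    using * norm_triangle_ineq2[of ?e ?d] by simp
  show "norm ?d \<le> 2 * norm ?e"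
    using * norm_triangle_ineq2[of ?d ?e] norm_ge_zero[of ?e] norm_minus_commute[of ?d ?e] by linarith
qed

text \<open>Evaluation at t gives the l1 lower bound for nonnegative coefficients, and suppression
  extends it to all signs at the cost 2m. To move into X the \<open>d k\<close> are replaced by the
  \<open>z k\<close>: single terms of a block have norm at most B and the blocks are disjoint, so
  the changes of the blocks tend to 0.\<close>

lemma perturbed_blocks_span_l1:
  fixes d z :: "nat \<Rightarrow> C2N" and I :: "nat \<Rightarrow> nat set"
  assumes X: "subspace X" "closed X" "\<And>k. z k \<in> X"
    and near: "\<And>k. norm (z k - d k) \<le> (1/2)^k * norm (d k)"
    and m: "suppression m d" "m \<ge> 1" and \<eta>: "\<eta> > 0"
    and I: "disjoint_family I" "\<And>j. finite (I j)"
    and B: "\<And>j J. J \<subseteq> I j \<Longrightarrow> norm (\<Sum>k\<in>J. b j k *\<^sub>R d k) \<le> B"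
    and low: "\<And>j. (\<Sum>k\<in>I j. b j k *\<^sub>R d k) t \<ge> \<eta>"
  shows "contains_l1 X"
proof -
  define x where "x j = (\<Sum>k\<in>I j. b j k *\<^sub>R d k)" for j
  define y where "y j = (\<Sum>k\<in>I j. b j k *\<^sub>R z k)" for j
  define s where "s j = (\<Sum>k\<in>I j. (1/2::real)^k)" for j
  have B0: "0 \<le> B" using B[of "{}" 0] by simp
  have xy: "norm (y j - x j) \<le> B * s j" for j
  proof -
    have "norm (y j - x j) = norm (\<Sum>k\<in>I j. b j k *\<^sub>R (z k - d k))"
      by (simp add: x_def y_def sum_subtractf scaleR_right_diff_distrib)
    also have "\<dots> \<le> (\<Sum>k\<in>I j. B * (1/2)^k)"
    proof (rule sum_norm_le)
      fix k assume "k \<in> I j"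
      have "norm (b j k *\<^sub>R (z k - d k)) \<le> \<bar>b j k\<bar> * ((1/2)^k * norm (d k))"
        using mult_left_mono[OF near[of k], of "\<bar>b j k\<bar>"] by simp
      also have "\<dots> = norm (\<Sum>i\<in>{k}. b j i *\<^sub>R d i) * (1/2)^k" by simp
      also have "\<dots> \<le> B * (1/2)^k"
        using \<open>k \<in> I j\<close> by (intro mult_right_mono B) auto
      finally show "norm (b j k *\<^sub>R (z k - d k)) \<le> B * (1/2)^k" .
    qed
    finally show ?thesis by (simp add: s_def sum_distrib_left)
  qed
  have s0: "0 \<le> s j" for j by (simp add: s_def sum_nonneg)
  have "(\<Sum>j<N. s j) \<le> 2" for N
  proof -
    have "(\<Sum>j<N. s j) = (\<Sum>k\<in>(\<Union>j<N. I j). (1/2)^k)"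
      unfolding s_def using I by (subst sum.UNION_disjoint) (auto simp: disjoint_family_on_def)
    also have "\<dots> \<le> (\<Sum>k. (1/2)^k)"
      by (rule sum_le_suminf) (use I(2) in \<open>auto intro: summable_geometric\<close>)
    finally show ?thesis by (simp add: suminf_geometric)
  qed
  then have "summable s" by (rule summableI_nonneg_bounded[OF s0])
  then have "(\<lambda>j. B * s j) \<longlonglongrightarrow> B * 0"
    by (intro tendsto_mult_left summable_LIMSEQ_zero)
  moreover have \<gamma>: "\<eta> / (4 * m) > 0" using \<eta> m(2) by simp
  \<comment> \<open>From n on the blocks move by at most half of the lower constant \<eta>/(2m),
    which leaves \<eta>/(4m).\<close>
  ultimately have "\<exists>n. \<forall>j\<ge>n. \<bar>B * s j\<bar> < \<eta> / (4 * m)"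
    using LIMSEQ_D[of "\<lambda>j. B * s j" 0 "\<eta> / (4 * m)"] by simp
  then obtain n where n: "\<And>j. j \<ge> n \<Longrightarrow> B * s j \<le> \<eta> / (4 * m)"
    by (meson abs_le_D1 less_imp_le)
  define u where "u j = x (n + j)" for j
  define v where "v j = y (n + j)" for j
  have uv: "norm (v j - u j) \<le> \<eta> / (4 * m)" for j
    using xy[of "n + j"] n[of "n + j"] by (simp add: u_def v_def)
  have uB: "norm (u j) \<le> B" for j using B[of "I (n + j)" "n + j"] by (simp add: u_def x_def)
  define K where "K = B + \<eta> / (4 * m)"
  have vK: "norm (v j) \<le> K" for j
    using norm_triangle_ineq[of "v j - u j" "u j"] uv[of j] uB[of j] by (simp add: K_def)
  have lower: "norm (\<Sum>j<N. a j *\<^sub>R u j) \<ge> \<eta> / (2 * m) * (\<Sum>j<N. \<bar>a j\<bar>)" for a N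
  proof -
    define I' where "I' j = I (n + j)" for j
    have dI: "I' i \<inter> I' j = {}" if "i \<noteq> j" for i j
      using I(1) that unfolding I'_def disjoint_family_on_def by simp
    have fI: "finite (I' j)" for j using I(2) by (simp add: I'_def)
    define g where "g k = (\<Sum>j<N. if k \<in> I' j then a j * b (n + j) k else 0)" for k
    have g: "g k = a j * b (n + j) k" if "j < N" "k \<in> I' j" for j k
    proof -
      have "g k = (\<Sum>i<N. if i = j then a j * b (n + j) k else 0)"
        unfolding g_def using dI that(2) by (intro sum.cong) auto
      then show ?thesis using that(1) by simp
    qed
    have block: "(\<Sum>j\<in>Q. a j *\<^sub>R u j) = (\<Sum>k\<in>(\<Union>j\<in>Q. I' j). g k *\<^sub>R d k)" if "Q \<subseteq> {..<N}" for Q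
    proof -
      have "finite Q" using that finite_subset by blast
      then have "(\<Sum>k\<in>(\<Union>j\<in>Q. I' j). g k *\<^sub>R d k) = (\<Sum>j\<in>Q. \<Sum>k\<in>I' j. g k *\<^sub>R d k)"
        using fI dI by (intro sum.UNION_disjoint) auto
      also have "\<dots> = (\<Sum>j\<in>Q. a j *\<^sub>R u j)"
      proof (rule sum.cong[OF refl])
        fix j assume "j \<in> Q"
        then have "(\<Sum>k\<in>I' j. g k *\<^sub>R d k) = (\<Sum>k\<in>I' j. a j *\<^sub>R (b (n + j) k *\<^sub>R d k))"
          using that g by (intro sum.cong) auto
        then show "(\<Sum>k\<in>I' j. g k *\<^sub>R d k) = a j *\<^sub>R u j"
          by (simp add: u_def x_def I'_def scaleR_sum_right)
      qed
      finally show ?thesis by simp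
    qed
    let ?S = "\<Sum>j<N. a j *\<^sub>R u j"
    have part: "norm (\<Sum>j\<in>Q. a j *\<^sub>R u j) \<le> m * norm ?S" if "Q \<subseteq> {..<N}" for Q
      unfolding block[OF that] block[OF order_refl]
      by (rule suppressionD[OF m(1)]) (use fI that in auto)
    \<comment> \<open>With absolute values as coefficients the sum is the part over nonnegative
      \<open>a j\<close> minus the part over negative ones, each controlled by suppression.\<close>
    let ?P = "{j \<in> {..<N}. a j \<ge> 0}" and ?Q = "{j \<in> {..<N}. \<not> a j \<ge> 0}"
    have "(\<Sum>j<N. \<bar>a j\<bar> *\<^sub>R u j) = (\<Sum>j\<in>?P. \<bar>a j\<bar> *\<^sub>R u j) + (\<Sum>j\<in>?Q. \<bar>a j\<bar> *\<^sub>R u j)"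
      by (subst sum.union_disjoint[symmetric]) (auto intro!: sum.cong)
    also have "\<dots> = (\<Sum>j\<in>?P. a j *\<^sub>R u j) - (\<Sum>j\<in>?Q. a j *\<^sub>R u j)"
      by (simp add: sum_negf[symmetric])
    finally have pq: "(\<Sum>j<N. \<bar>a j\<bar> *\<^sub>R u j) = (\<Sum>j\<in>?P. a j *\<^sub>R u j) - (\<Sum>j\<in>?Q. a j *\<^sub>R u j)" .
    have "norm (\<Sum>j<N. \<bar>a j\<bar> *\<^sub>R u j) \<le> m * norm ?S + m * norm ?S"
      unfolding pq using norm_triangle_ineq4[of "\<Sum>j\<in>?P. a j *\<^sub>R u j" "\<Sum>j\<in>?Q. a j *\<^sub>R u j"]
        part[of ?P, OF Collect_restrict] part[of ?Q, OF Collect_restrict] by linarith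
    moreover have "\<eta> * (\<Sum>j<N. \<bar>a j\<bar>) \<le> (\<Sum>j<N. \<bar>a j\<bar> *\<^sub>R u j) t"
    proof -
      have "\<eta> \<le> u j t" for j using low[of "n + j"] by (simp add: u_def x_def)
      then have "(\<Sum>j<N. \<bar>a j\<bar> * \<eta>) \<le> (\<Sum>j<N. \<bar>a j\<bar> * u j t)"
        by (intro sum_mono mult_left_mono) auto
      then show ?thesis by (simp add: sum_distrib_left mult.commute)
    qed
    moreover have "(\<Sum>j<N. \<bar>a j\<bar> *\<^sub>R u j) t \<le> norm (\<Sum>j<N. \<bar>a j\<bar> *\<^sub>R u j)"
      using C2N_norm_bounded abs_le_D1 by blast
    ultimately have "\<eta> * (\<Sum>j<N. \<bar>a j\<bar>) \<le> 2 * m * norm ?S" by simp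
    then show ?thesis using m(2) by (simp add: field_simps)
  qed
  have lower': "norm (\<Sum>j<N. a j *\<^sub>R v j) \<ge> \<eta> / (4 * m) * (\<Sum>j<N. \<bar>a j\<bar>)" for a N
  proof -
    have "norm ((\<Sum>j<N. a j *\<^sub>R u j) - (\<Sum>j<N. a j *\<^sub>R v j)) = norm (\<Sum>j<N. a j *\<^sub>R (v j - u j))"
      by (simp add: sum_subtractf scaleR_right_diff_distrib norm_minus_commute)
    also have "\<dots> \<le> (\<Sum>j<N. \<bar>a j\<bar> * (\<eta> / (4 * m)))"
      by (rule sum_norm_le, unfold norm_scaleR, rule mult_left_mono[OF uv]) simp
    also have "\<dots> = \<eta> / (4 * m) * (\<Sum>j<N. \<bar>a j\<bar>)"
      by (subst sum_distrib_right[symmetric]) (rule mult.commute)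
    finally have "norm (\<Sum>j<N. a j *\<^sub>R u j) - norm (\<Sum>j<N. a j *\<^sub>R v j) \<le> \<eta> / (4 * m) * (\<Sum>j<N. \<bar>a j\<bar>)"
      using norm_triangle_ineq2 order_trans by blast
    moreover have "\<eta> / (2 * m) = 2 * (\<eta> / (4 * m))" by simp
    ultimately show ?thesis using lower[where a = a and N = N] by (simp add: mult.assoc)
  qed
  have sm: "summable (\<lambda>j. a j *\<^sub>R v j)" "summable (\<lambda>j. K * \<bar>a j\<bar>)" if "a \<in> l1" for a
  proof -
    show s: "summable (\<lambda>j. K * \<bar>a j\<bar>)" using that by (intro summable_mult) (simp add: l1_def)
    show "summable (\<lambda>j. a j *\<^sub>R v j)"
      by (rule summable_comparison_test'[OF s])
         (simp add: mult.commute[of K] mult_left_mono[OF vK])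
  qed
  define T where "T a = (\<Sum>j. a j *\<^sub>R v j)" for a
  have Ts: "(\<lambda>j. a j *\<^sub>R v j) sums T a" if "a \<in> l1" for a
    using sm(1)[OF that] by (simp add: T_def summable_sums)
  have vX: "v j \<in> X" for j
    unfolding v_def y_def using X by (intro subspace_sum subspace_scale)
  show ?thesis
    unfolding contains_l1_def
  proof (intro exI[of _ T] conjI ballI allI)
    show "T a \<in> X" if "a \<in> l1" for a
      using closed_sequentially[OF X(2) _ Ts[OF that, unfolded sums_def]] X(1) vX
      by (simp add: subspace_sum subspace_scale)
    show "T (\<lambda>n. s * a n + t * b n) = s *\<^sub>R T a + t *\<^sub>R T b" if "a \<in> l1" "b \<in> l1" for a b s t
    proof -
      have "(\<lambda>j. s *\<^sub>R (a j *\<^sub>R v j) + t *\<^sub>R (b j *\<^sub>R v j)) sums (s *\<^sub>R T a + t *\<^sub>R T b)"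
        by (intro sums_add sums_scaleR_right Ts that)
      then show ?thesis by (simp add: T_def sums_iff scaleR_left_distrib)
    qed
    have "\<eta> / (4 * m) * l1_norm a \<le> norm (T a)" "norm (T a) \<le> K * l1_norm a" if "a \<in> l1" for a
    proof -
      have a: "summable (\<lambda>n. \<bar>a n\<bar>)" using that by (simp add: l1_def)
      have T: "(\<lambda>N. norm (\<Sum>j<N. a j *\<^sub>R v j)) \<longlonglongrightarrow> norm (T a)"
        using Ts[OF that] unfolding sums_def by (rule tendsto_norm)
      have "(\<lambda>N. \<eta> / (4 * m) * (\<Sum>j<N. \<bar>a j\<bar>)) \<longlonglongrightarrow> \<eta> / (4 * m) * l1_norm a"
        unfolding l1_norm_def by (intro tendsto_mult_left summable_LIMSEQ a)
      from LIMSEQ_le[OF this T] show "\<eta> / (4 * m) * l1_norm a \<le> norm (T a)"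
        using lower' by blast
      have "norm (T a) \<le> (\<Sum>j. K * \<bar>a j\<bar>)"
        unfolding T_def
        by (rule norm_suminf_le[OF _ sm(2)[OF that]])
           (simp add: mult.commute[of K] mult_left_mono[OF vK])
      then show "norm (T a) \<le> K * l1_norm a"
        using a by (simp add: l1_norm_def suminf_mult)
    qed
    then show "\<exists>c>0. \<exists>K. \<forall>a\<in>l1. c * l1_norm a \<le> norm (T a) \<and> norm (T a) \<le> K * l1_norm a"
      using \<gamma> by blast
  qed
qed

text \<open>With equality as comparability the chains are singletons and the amalgam is a copy of
\<open>c\<^sub>0\<close>.\<close>

lemma UB_no_l1_nonempty: "UB_no_l1 \<noteq> {}"
proof -
  have nz: "const_bcontfun 1 \<noteq> (0 :: C2N)"
    by (metis C2N_apply_simps(4) const_bcontfun.rep_eq zero_neq_one)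
  interpret amalgamation "(=)" "\<lambda>_. const_bcontfun 1"
    by standard (use nz in auto)
  have no_chain: False if C: "infinite C" "chain C" for C
  proof -
    obtain i where "i \<in> C" using C(1) infinite_imp_nonempty by blast
    then have "C \<subseteq> {i}" using C(2) by (auto simp: chain_def)
    then show False using C(1) finite_subset by blast
  qed
  have "\<not> contains_l1 Y"
    by (rule Y_no_l1) (use no_chain in blast)
  then show ?thesis using Y_SB Y_unconditional by (auto simp: UB_no_l1_def)
qed

section \<open>The tree of a closed set and its amalgam\<close>

text \<open>The last clause bounds sums of the \<open>E k\<close> by the largest sum of g over a
  subset of F, with b in place of a maximum; a suppression constant of g thus becomes an equivalence
  constant.\<close>

definition suppression_copy :: "C2N set \<Rightarrow> (nat \<Rightarrow> C2N) \<Rightarrow> bool" where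
  "suppression_copy Y g \<longleftrightarrow> (\<exists>E. (\<forall>k. E k \<in> Y) \<and>
     (\<forall>F a. finite F \<longrightarrow> norm (\<Sum>k\<in>F. a k *\<^sub>R g k) \<le> norm (\<Sum>k\<in>F. a k *\<^sub>R E k)) \<and>
     (\<forall>F a b. finite F \<longrightarrow> (\<forall>H\<subseteq>F. norm (\<Sum>k\<in>H. a k *\<^sub>R g k) \<le> b) \<longrightarrow>
        norm (\<Sum>k\<in>F. a k *\<^sub>R E k) \<le> b))"

text \<open>Closedness of G is decisive: an infinite chain of nodes determines a sequence each of
  whose initial segments extends to a member of G, and \<open>P\<close> can be applied only once the
  sequence itself lies in G.\<close>

lemma tree_amalgam:
  fixes G :: "(nat \<Rightarrow> nat) set" and \<delta> :: "nat \<Rightarrow> C2N"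
  assumes G: "closed G" "G \<noteq> {}" and nz: "\<And>i. \<delta> i \<noteq> 0"
    and P: "\<And>\<sigma> t I b B \<eta>. \<sigma> \<in> G \<Longrightarrow> \<eta> > 0 \<Longrightarrow> disjoint_family (I :: nat \<Rightarrow> nat set) \<Longrightarrow>
      (\<And>j. finite (I j)) \<Longrightarrow>
      (\<And>j J. J \<subseteq> I j \<Longrightarrow> norm (\<Sum>k\<in>J. b j k *\<^sub>R \<delta> (\<sigma> k)) \<le> B) \<Longrightarrow>
      (\<And>j. (\<Sum>k\<in>I j. b j k *\<^sub>R \<delta> (\<sigma> k)) t \<ge> \<eta>) \<Longrightarrow> False"
  shows "\<exists>Y\<in>UB_no_l1. \<forall>\<sigma>\<in>G. suppression_copy Y (\<lambda>k. \<delta> (\<sigma> k))"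
proof -
  \<comment> \<open>Nodes are nonempty initial segments, so that the last entry always names a
    vector.\<close>
  define nd where "nd \<sigma> k = map \<sigma> [0..<Suc k]" for \<sigma> :: "nat \<Rightarrow> nat" and k
  have len: "length (nd \<sigma> k) = Suc k" and nth: "i \<le> k \<Longrightarrow> nd \<sigma> k ! i = \<sigma> i"
    and lst: "last (nd \<sigma> k) = \<sigma> k" for \<sigma> k i
    by (auto simp: nd_def simp del: upt_Suc) (simp add: last_map)
  define T where "T = {nd \<sigma> k |\<sigma> k. \<sigma> \<in> G}"
  define \<nu> where "\<nu> = from_nat_into T"
  obtain \<sigma>0 where "\<sigma>0 \<in> G" using G(2) by blast
  have "inj (nd \<sigma>0)" using len by (metis injI nat.inject)
  then have "infinite (range (nd \<sigma>0))" using finite_imageD infinite_UNIV_nat by blast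
  moreover have "range (nd \<sigma>0) \<subseteq> T" using \<open>\<sigma>0 \<in> G\<close> by (auto simp: T_def)
  ultimately have "infinite T" using finite_subset by blast
  then have \<nu>: "bij_betw \<nu> UNIV T"
    unfolding \<nu>_def by (intro bij_betw_from_nat_into) auto
  then have \<nu>inj: "\<nu> i = \<nu> j \<longleftrightarrow> i = j" for i j
    by (auto simp: bij_betw_def inj_on_def)
  have \<nu>T: "\<exists>\<sigma> k. \<sigma> \<in> G \<and> \<nu> n = nd \<sigma> k" for n
  proof -
    have "\<nu> n \<in> T" using \<nu> by (auto simp: bij_betw_def)
    then show ?thesis by (auto simp: T_def)
  qed
  \<comment> \<open>Agreement on the common length, that is, one node extends the other.\<close>
  define cmp where "cmp m n \<longleftrightarrow> (\<forall>i. i < length (\<nu> m) \<longrightarrow> i < length (\<nu> n) \<longrightarrow> \<nu> m ! i = \<nu> n ! i)" for m n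
  interpret amalgamation cmp "\<lambda>n. \<delta> (last (\<nu> n))"
    by standard (auto simp: cmp_def nz)
  have "\<not> contains_l1 Y"
  proof (rule Y_no_l1)
    fix C t I b B \<eta>
    assume C: "infinite C" "chain C" and \<eta>: "(\<eta> :: real) > 0"
      and I: "disjoint_family (I :: nat \<Rightarrow> nat set)" "\<And>j. finite (I j)" "\<And>j. I j \<subseteq> C"
      and B: "\<And>j J. J \<subseteq> I j \<Longrightarrow> norm (\<Sum>n\<in>J. b j n *\<^sub>R \<delta> (last (\<nu> n))) \<le> B"
      and low: "\<And>j. (\<Sum>n\<in>I j. b j n *\<^sub>R \<delta> (last (\<nu> n))) t \<ge> \<eta>"
    define L where "L n = length (\<nu> n) - 1" for n
    have lenL: "length (\<nu> n) = Suc (L n)" for n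
      using \<nu>T[of n] len by (auto simp: L_def)
    \<comment> \<open>Comparable nodes of equal length coincide, so an infinite chain has nodes of
      unbounded length.\<close>
    have Linj: "inj_on L C"
    proof (rule inj_onI)
      fix i j assume ij: "i \<in> C" "j \<in> C" "L i = L j"
      then have "cmp i j" using C(2) by (auto simp: chain_def)
      then have "\<nu> i = \<nu> j"
        unfolding cmp_def using ij(3) lenL by (intro nth_equalityI) auto
      then show "i = j" by (simp add: \<nu>inj)
    qed
    then have "infinite (L ` C)" using C(1) finite_image_iff by blast
    then have big: "\<exists>n\<in>C. L n \<ge> i" for i
      unfolding infinite_nat_iff_unbounded_le by auto
    then obtain N where N: "\<And>i. N i \<in> C" "\<And>i. L (N i) \<ge> i" by metis
    define \<sigma> where "\<sigma> i = \<nu> (N i) ! i" for i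
    have \<sigma>: "\<nu> n ! i = \<sigma> i" if "n \<in> C" "i \<le> L n" for n i
    proof -
      have "cmp n (N i)" using C(2) N(1) that(1) by (auto simp: chain_def)
      then show ?thesis using that(2) N(2)[of i] lenL by (auto simp: cmp_def \<sigma>_def)
    qed
    have \<sigma>G: "\<sigma> \<in> G"
    proof (rule closed_baire_approx[OF G(1)])
      fix n
      obtain \<tau> k where \<tau>: "\<tau> \<in> G" "\<nu> (N n) = nd \<tau> k" using \<nu>T by blast
      have "k = L (N n)" using \<tau>(2) lenL[of "N n"] len by simp
      then have "\<tau> i = \<sigma> i" if "i < n" for i
        using \<sigma>[OF N(1), of i n] N(2)[of n] that nth[of i k \<tau>] \<tau>(2) by simp
      then show "\<exists>\<sigma>'\<in>G. \<forall>i<n. \<sigma>' i = \<sigma> i" using \<tau>(1) by blast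
    qed
    have last: "last (\<nu> n) = \<sigma> (L n)" if "n \<in> C" for n
      using \<sigma>[OF that, of "L n"] lenL[of n] by (metis L_def last_conv_nth length_0_conv nat.distinct(1) order_refl)
    \<comment> \<open>Blocks are transported from nodes to their levels; L is injective on the
      chain, so sums and disjointness are preserved.\<close>
    define b' where "b' j k = b j (inv_into C L k)" for j k
    have reindex: "(\<Sum>k\<in>L ` J. b' j k *\<^sub>R \<delta> (\<sigma> k)) = (\<Sum>n\<in>J. b j n *\<^sub>R \<delta> (last (\<nu> n)))" if "J \<subseteq> C" for j J
    proof -
      have "(\<Sum>k\<in>L ` J. b' j k *\<^sub>R \<delta> (\<sigma> k)) = (\<Sum>n\<in>J. b' j (L n) *\<^sub>R \<delta> (\<sigma> (L n)))"
        using inj_on_subset[OF Linj that] by (simp add: sum.reindex)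
      also have "\<dots> = (\<Sum>n\<in>J. b j n *\<^sub>R \<delta> (last (\<nu> n)))"
        using that last by (intro sum.cong) (auto simp: b'_def inv_into_f_f[OF Linj])
      finally show ?thesis .
    qed
    show False
    proof (rule P[of \<sigma> \<eta> "\<lambda>j. L ` I j" b' B t])
      show "\<sigma> \<in> G" by (rule \<sigma>G)
      show "\<eta> > 0" by (rule \<eta>)
      show "disjoint_family (\<lambda>j. L ` I j)"
        unfolding disjoint_family_on_def
      proof (intro ballI impI)
        fix i j :: nat assume "i \<noteq> j"
        then have "I i \<inter> I j = {}" using I(1) by (simp add: disjoint_family_on_def)
        then show "L ` I i \<inter> L ` I j = {}"
          using inj_on_image_Int[OF Linj I(3) I(3), of i j] by simp
      qed
      show "finite (L ` I j)" for j using I(2) by simp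
      show "norm (\<Sum>k\<in>J. b' j k *\<^sub>R \<delta> (\<sigma> k)) \<le> B" if J: "J \<subseteq> L ` I j" for j J
      proof -
        obtain J' where "J' \<subseteq> I j" "J = L ` J'" using J by (meson subset_imageE)
        then show ?thesis using reindex[of J' j] B I(3)[of j] by auto
      qed
      show "(\<Sum>k\<in>L ` I j. b' j k *\<^sub>R \<delta> (\<sigma> k)) t \<ge> \<eta>" for j
        unfolding reindex[OF I(3)] by (rule low)
    qed
  qed
  then have "Y \<in> UB_no_l1" using Y_SB Y_unconditional by (auto simp: UB_no_l1_def)
  moreover have "suppression_copy Y (\<lambda>k. \<delta> (\<sigma> k))" if "\<sigma> \<in> G" for \<sigma>
  proof -
    have "\<exists>n. \<nu> n = nd \<sigma> k" for k
    proof -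
      have "nd \<sigma> k \<in> T" using that by (auto simp: T_def)
      also have "T = range \<nu>" using \<nu> by (simp add: bij_betw_def)
      finally show ?thesis by auto
    qed
    then obtain p where p: "\<And>k. \<nu> (p k) = nd \<sigma> k" by metis
    have pinj: "inj p" using p len by (metis injI nat.inject)
    have Dp: "\<delta> (last (\<nu> (p k))) = \<delta> (\<sigma> k)" for k by (simp add: p lst)
    have ch: "chain (p ` F)" for F
      by (auto simp: chain_def cmp_def p len nth)
    have reE: "(\<Sum>k\<in>F. a k *\<^sub>R f (p k)) = (\<Sum>n\<in>p ` F. a (inv p n) *\<^sub>R f n)"
      for F a and f :: "nat \<Rightarrow> C2N"
      using inj_on_subset[OF pinj] by (subst sum.reindex) (auto simp: pinj)
    have EY: "E (p k) \<in> Y" for k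
      unfolding Y_def by (meson closure_subset rangeI span_base subsetD)
    have lo: "norm (\<Sum>k\<in>F. a k *\<^sub>R \<delta> (\<sigma> k)) \<le> norm (\<Sum>k\<in>F. a k *\<^sub>R E (p k))" if "finite F" for F a
      using norm_chain_le[OF ch order_refl, of F "\<lambda>n. a (inv p n)"] that
        reE[of a E F] reE[of a "\<lambda>n. \<delta> (last (\<nu> n))" F] by (simp add: Dp)
    have up: "norm (\<Sum>k\<in>F. a k *\<^sub>R E (p k)) \<le> b"
      if "finite F" and H: "\<forall>H\<subseteq>F. norm (\<Sum>k\<in>H. a k *\<^sub>R \<delta> (\<sigma> k)) \<le> b" for F a b
      unfolding reE[of a E F]
    proof (rule norm_le_chains)
      show "finite (p ` F)" using that by simp
      fix C assume "C \<subseteq> p ` F"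
      then obtain H' where "H' \<subseteq> F" "C = p ` H'" by (meson subset_imageE)
      moreover from this have "norm (\<Sum>k\<in>H'. a k *\<^sub>R \<delta> (\<sigma> k)) \<le> b" using H by blast
      ultimately show "norm (\<Sum>n\<in>C. a (inv p n) *\<^sub>R \<delta> (last (\<nu> n))) \<le> b"
        using reE[of a "\<lambda>n. \<delta> (last (\<nu> n))" H'] by (simp add: Dp)
    qed
    show ?thesis
      unfolding suppression_copy_def
    proof (intro exI[of _ "\<lambda>k. E (p k)"] conjI allI impI)
      show "E (p k) \<in> Y" for k by (rule EY)
    qed (blast intro: lo up)+
  qed
  ultimately show ?thesis by blast
qed

text \<open>Each \<open>w k\<close> is the code of a pair: the first components pick a sequence from the dense sequence
\<open>d\<close>, the second ones form the parameter of a space in the range of \<open>f\<close>. The sequence need only be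
close to vectors of that space, not to a basis of it: this suffices to exclude \<open>\<ell>\<^sub>1\<close>.\<close>

definition codes_basis :: "(nat \<Rightarrow> C2N) \<Rightarrow> ((nat \<Rightarrow> nat) \<Rightarrow> C2N set) \<Rightarrow> (nat \<Rightarrow> nat) \<Rightarrow> bool" where
  "codes_basis d f w \<longleftrightarrow>
     (\<exists>m::nat. m \<ge> 1 \<and> suppression (real m) (\<lambda>k. d (fst (prod_decode (w k))))) \<and>
     (\<forall>k. f (\<lambda>k. snd (prod_decode (w k))) \<inter>
          ball (d (fst (prod_decode (w k)))) ((1/2)^k * norm (d (fst (prod_decode (w k))))) \<noteq> {})"

section \<open>Measurability and existence of codes\<close>

text \<open>Each inequality involves the entries of w at finitely many indices, where a convergent
  sequence is eventually constant.\<close>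

lemma closed_suppression:
  fixes d :: "nat \<Rightarrow> 'a::real_normed_vector" and h :: "nat \<Rightarrow> nat"
  shows "closed {w :: nat \<Rightarrow> nat. suppression K (\<lambda>k. d (h (w k)))}"
  unfolding closed_sequential_limits
proof (intro allI impI, elim conjE)
  fix x l
  assume x: "\<forall>n. x n \<in> {w. suppression K (\<lambda>k. d (h (w k)))}" and l: "x \<longlonglongrightarrow> l"
  have "suppression K (\<lambda>k. d (h (l k)))"
    unfolding suppression_def
  proof (intro allI impI)
    fix F G :: "nat set" and a assume F: "finite F" "G \<subseteq> F"
    have "\<forall>i\<in>F. \<forall>\<^sub>F n in sequentially. x n i = l i"
      using l by (simp add: tendsto_baire_iff)
    then have "\<forall>\<^sub>F n in sequentially. \<forall>i\<in>F. x n i = l i"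
      using F(1) by (simp add: eventually_ball_finite_distrib)
    then obtain n where n: "\<forall>i\<in>F. x n i = l i"
      by (auto simp: eventually_sequentially)
    have "norm (\<Sum>i\<in>G. a i *\<^sub>R d (h (x n i))) \<le> K * norm (\<Sum>i\<in>F. a i *\<^sub>R d (h (x n i)))"
      using x F by (auto intro: suppressionD[of K "\<lambda>k. d (h (x n k))"])
    moreover have "(\<Sum>i\<in>G. a i *\<^sub>R d (h (x n i))) = (\<Sum>i\<in>G. a i *\<^sub>R d (h (l i)))"
      "(\<Sum>i\<in>F. a i *\<^sub>R d (h (x n i))) = (\<Sum>i\<in>F. a i *\<^sub>R d (h (l i)))"
      using n F(2) by (auto intro!: sum.cong)
    ultimately show "norm (\<Sum>i\<in>G. a i *\<^sub>R d (h (l i))) \<le> K * norm (\<Sum>i\<in>F. a i *\<^sub>R d (h (l i)))"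
      by simp
  qed
  then show "l \<in> {w. suppression K (\<lambda>k. d (h (w k)))}" by simp
qed

lemma Effros_hit_measurable:
  assumes "f \<in> measurable M Effros_Borel" "open U"
  shows "{w \<in> space M. f w \<inter> U \<noteq> {}} \<in> sets M"
proof -
  let ?gen = "{{X \<in> SB. X \<inter> U \<noteq> {}} | U. open U}"
  have gen: "?gen \<subseteq> Pow SB" by auto
  have sp: "space Effros_Borel = SB"
    unfolding Effros_Borel_def by (rule space_measure_of[OF gen])
  have "{X \<in> SB. X \<inter> U \<noteq> {}} \<in> sets Effros_Borel"
    unfolding Effros_Borel_def sets_measure_of[OF gen] using assms(2) by blast
  from measurable_sets[OF assms(1) this]
  have "f -` {X \<in> SB. X \<inter> U \<noteq> {}} \<inter> space M \<in> sets M" .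
  moreover have "f -` {X \<in> SB. X \<inter> U \<noteq> {}} \<inter> space M = {w \<in> space M. f w \<inter> U \<noteq> {}}"
    using measurable_space[OF assms(1)] sp by auto
  ultimately show ?thesis by simp
qed

lemma borel_codes_basis:
  assumes f: "f \<in> measurable (borel :: (nat \<Rightarrow> nat) measure) Effros_Borel"
  shows "{w. codes_basis d f w} \<in> sets borel"
proof -
  let ?fs = "\<lambda>(w :: nat \<Rightarrow> nat) (k :: nat). fst (prod_decode (w k))"
    and ?sn = "\<lambda>(w :: nat \<Rightarrow> nat) (k :: nat). snd (prod_decode (w k))"
  have "continuous_on UNIV ?sn"
  proof (rule continuous_on_baireI)
    fix x l assume "x \<longlonglongrightarrow> (l :: nat \<Rightarrow> nat)"
    then have ev: "\<forall>\<^sub>F n in sequentially. x n i = l i" for i by (simp add: tendsto_baire_iff)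
    show "(\<lambda>n. ?sn (x n)) \<longlonglongrightarrow> ?sn l"
      unfolding tendsto_baire_iff
    proof
      show "\<forall>\<^sub>F n in sequentially. ?sn (x n) i = ?sn l i" for i
        using ev[of i] by eventually_elim simp
    qed
  qed
  then have "?sn \<in> measurable borel borel" by (rule borel_measurable_continuous_onI)
  then have fsn: "(\<lambda>w. f (?sn w)) \<in> measurable borel Effros_Borel"
    using f by (rule measurable_compose)
  \<comment> \<open>The centre of the ball depends on w; splitting by the value i of its index
    leaves hits of fixed open balls, which the Effros structure measures.\<close>
  have eq: "{w. codes_basis d f w} =
     (\<Union>m\<in>{1..}. {w. suppression (real m) (\<lambda>k. d (?fs w k))}) \<inter>
     (\<Inter>k. \<Union>i. {w. ?fs w k = i} \<inter> {w. f (?sn w) \<inter> ball (d i) ((1/2)^k * norm (d i)) \<noteq> {}})"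
    by (auto simp: codes_basis_def)
  have "{w. ?fs w k = i} \<in> sets borel" for k i
  proof -
    have "open ((\<lambda>w :: nat \<Rightarrow> nat. w k) -` {j. fst (prod_decode j) = i})"
      by (intro open_vimage open_discrete continuous_on_product_coordinates)
    then show ?thesis by (simp add: vimage_def)
  qed
  moreover have "{w. suppression (real m) (\<lambda>k. d (?fs w k))} \<in> sets borel" for m
    using closed_suppression[of "real m" d "\<lambda>j. fst (prod_decode j)"] by simp
  moreover have "{w. f (?sn w) \<inter> ball (d i) r \<noteq> {}} \<in> sets borel" for i r
    using Effros_hit_measurable[OF fsn, of "ball (d i) r"] by simp
  ultimately show ?thesis
    unfolding eq by (intro sets.Int sets.countable_UN'' sets.countable_INT'' countableI_type) auto
qed

text \<open>One relative tolerance (1/2)^k/(4M) serves twice: it makes the approximants equivalent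
  to the basis, and, as \<open>e k\<close> has at most twice the norm of its approximant, it implies
  the nearness asked for in \<open>codes_basis\<close>.\<close>

lemma basis_code_exists:
  assumes d: "\<And>n. d n \<noteq> 0" "\<forall>g \<epsilon>. g \<noteq> 0 \<longrightarrow> \<epsilon> > 0 \<longrightarrow> (\<exists>n. norm (g - d n) < \<epsilon>)"
    and X: "f \<tau> = X" "X \<in> UB_no_l1"
  obtains w e M where "codes_basis d f w" "suppression M e" "\<And>k. e k \<noteq> 0" "X \<subseteq> closure (span (range e))"
    "\<And>F a. finite F \<Longrightarrow> norm (\<Sum>k\<in>F. a k *\<^sub>R e k) \<le> 2 * norm (\<Sum>k\<in>F. a k *\<^sub>R d (fst (prod_decode (w k))))"
    "\<And>F a. finite F \<Longrightarrow> norm (\<Sum>k\<in>F. a k *\<^sub>R d (fst (prod_decode (w k)))) \<le> 2 * norm (\<Sum>k\<in>F. a k *\<^sub>R e k)"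
proof -
  obtain e where sub: "subspace X" "closed X" and e: "unconditional_basis X e"
    using X(2) by (auto simp: UB_no_l1_def SB_def has_unconditional_basis_def)
  obtain M0 where M0: "suppression M0 e" and nz: "\<And>n. e n \<noteq> 0"
    using unconditional_basis_suppression[OF sub e] by blast
  define M where "M = max M0 1"
  have M: "suppression M e" "M \<ge> 1"
  proof -
    show "suppression M e"
      unfolding suppression_def
    proof (intro allI impI)
      fix F G :: "nat set" and a assume "finite F" "G \<subseteq> F"
      then have "norm (\<Sum>i\<in>G. a i *\<^sub>R e i) \<le> M0 * norm (\<Sum>i\<in>F. a i *\<^sub>R e i)"
        by (rule suppressionD[OF M0])
      also have "\<dots> \<le> M * norm (\<Sum>i\<in>F. a i *\<^sub>R e i)"
        by (intro mult_right_mono) (auto simp: M_def)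
      finally show "norm (\<Sum>i\<in>G. a i *\<^sub>R e i) \<le> M * norm (\<Sum>i\<in>F. a i *\<^sub>R e i)" .
    qed
  qed (simp add: M_def)
  have "\<exists>i. norm (e k - d i) < (1/2)^k / (4 * M) * norm (e k)" for k
    by (rule d(2)[rule_format, OF nz]) (use nz M(2) in simp)
  then obtain i where i: "\<And>k. norm (e k - d (i k)) < (1/2)^k / (4 * M) * norm (e k)" by metis
  note pert = small_perturbation[OF M less_imp_le[OF i]]
  define w where "w k = prod_encode (i k, \<tau> k)" for k
  have w: "fst (prod_decode (w k)) = i k" "snd (prod_decode (w k)) = \<tau> k" for k
    by (auto simp: w_def)
  \<comment> \<open>The factor 4 arises because \<open>small_perturbation\<close> is used once in
    each direction, each time at cost 2, with M in between.\<close>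
  have supp: "suppression (4 * M) (\<lambda>k. d (i k))"
    unfolding suppression_def
  proof (intro allI impI)
    fix F G :: "nat set" and a assume F: "finite F" "G \<subseteq> F"
    then have G: "finite G" using finite_subset by blast
    have "norm (\<Sum>k\<in>G. a k *\<^sub>R d (i k)) \<le> 2 * norm (\<Sum>k\<in>G. a k *\<^sub>R e k)"
      by (rule pert(2)[OF G])
    also have "\<dots> \<le> 2 * (M * norm (\<Sum>k\<in>F. a k *\<^sub>R e k))"
      using suppressionD[OF M(1) F] by simp
    also have "\<dots> \<le> 2 * (M * (2 * norm (\<Sum>k\<in>F. a k *\<^sub>R d (i k))))"
      using pert(1)[OF F(1)] M(2) by (intro mult_left_mono) auto
    finally show "norm (\<Sum>k\<in>G. a k *\<^sub>R d (i k)) \<le> 4 * M * norm (\<Sum>k\<in>F. a k *\<^sub>R d (i k))" by simp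
  qed
  obtain m :: nat where m: "4 * M \<le> real m" using real_arch_simple by blast
  have "suppression (real m) (\<lambda>k. d (i k))"
    unfolding suppression_def
  proof (intro allI impI)
    fix F G :: "nat set" and a assume "finite F" "G \<subseteq> F"
    then have "norm (\<Sum>k\<in>G. a k *\<^sub>R d (i k)) \<le> 4 * M * norm (\<Sum>k\<in>F. a k *\<^sub>R d (i k))"
      by (rule suppressionD[OF supp])
    also have "\<dots> \<le> real m * norm (\<Sum>k\<in>F. a k *\<^sub>R d (i k))"
      using m by (intro mult_right_mono) auto
    finally show "norm (\<Sum>k\<in>G. a k *\<^sub>R d (i k)) \<le> real m * norm (\<Sum>k\<in>F. a k *\<^sub>R d (i k))" .
  qed
  moreover have "m \<ge> 1" using m M(2) by linarith
  moreover have "e k \<in> X \<inter> ball (d (i k)) ((1/2)^k * norm (d (i k)))" for k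
  proof -
    have "norm (e k) \<le> 2 * norm (d (i k))" using pert(1)[of "{k}" "\<lambda>_. 1"] by simp
    moreover have "(1/2)^k / (4 * M) \<le> (1/2)^k / 4"
      using M(2) by (intro divide_left_mono) auto
    ultimately have "(1/2)^k / (4 * M) * norm (e k) \<le> (1/2)^k / 4 * (2 * norm (d (i k)))"
      by (intro mult_mono) auto
    also have "\<dots> \<le> (1/2)^k * norm (d (i k))" by simp
    finally have "norm (e k - d (i k)) < (1/2)^k * norm (d (i k))"
      using i[of k] by linarith
    moreover have "e k \<in> X" using e by (auto simp: unconditional_basis_def schauder_basis_def)
    ultimately show ?thesis by (simp add: dist_norm norm_minus_commute)
  qed
  ultimately have "codes_basis d f w"
    unfolding codes_basis_def w using X(1) by blast
  moreover have "X \<subseteq> closure (span (range e))"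
    using e sums_in_closure_span by (fastforce simp: unconditional_basis_def schauder_basis_def)
  ultimately show ?thesis
    using that[of w M e] M(1) nz pert by (simp add: w)
qed

theorem theorem4p1:
  "strongly_bounded UB_no_l1"
  unfolding strongly_bounded_def
proof (intro allI impI, elim conjE)
  fix A assume AC: "A \<subseteq> UB_no_l1" and "analytic_SB A"
  then consider "A = {}" | f where "f \<in> measurable (borel :: (nat \<Rightarrow> nat) measure) Effros_Borel" "A = range f"
    unfolding analytic_SB_def by blast
  then show "\<exists>Y\<in>UB_no_l1. \<forall>X\<in>A. contains_copy Y X"
  proof cases
    case 1
    then show ?thesis using UB_no_l1_nonempty by auto
  next
    case (2 f)
    obtain d :: "nat \<Rightarrow> C2N" where d: "\<And>n. d n \<noteq> 0"
      "\<forall>g \<epsilon>. g \<noteq> 0 \<longrightarrow> \<epsilon> > 0 \<longrightarrow> (\<exists>n. norm (g - d n) < \<epsilon>)"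
      using C2N_dense_sequence by blast
    obtain G where G: "closed G" "{w. codes_basis d f w} = (\<lambda>\<sigma> k. fst (prod_decode (\<sigma> k))) ` G"
      using borel_projection_of_closed[OF borel_codes_basis[OF 2(1), of d]] by blast
    \<comment> \<open>Two layers of pairing: an entry of a branch of G pairs an entry of a code w
      with a witness, and an entry of w pairs an index into d with a value of the parameter of
      f.\<close>
    define \<delta> where "\<delta> i = d (fst (prod_decode (fst (prod_decode i))))" for i
    \<comment> \<open>Any one member of the range of f has a code, so the tree is not empty.\<close>
    have "f (\<lambda>_. 0) \<in> UB_no_l1" using AC 2(2) by auto
    obtain w where "codes_basis d f w"
      using basis_code_exists[of d f, OF d refl \<open>f (\<lambda>_. 0) \<in> UB_no_l1\<close>] by metis
    then have "{w. codes_basis d f w} \<noteq> {}" by blast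
    then have "G \<noteq> {}" using G(2) by auto
    have P: False if \<sigma>: "\<sigma> \<in> G" and blocks: "\<eta> > 0" "disjoint_family (I :: nat \<Rightarrow> nat set)"
      "\<And>j. finite (I j)" "\<And>j J. J \<subseteq> I j \<Longrightarrow> norm (\<Sum>k\<in>J. b j k *\<^sub>R \<delta> (\<sigma> k)) \<le> B"
      "\<And>j. (\<Sum>k\<in>I j. b j k *\<^sub>R \<delta> (\<sigma> k)) t \<ge> \<eta>" for \<sigma> t I b B \<eta>
    proof -
      define w where "w k = fst (prod_decode (\<sigma> k))" for k
      have "codes_basis d f w" using G(2) \<sigma> unfolding w_def by blast
      then obtain m where m: "m \<ge> 1" "suppression (real m) (\<lambda>k. \<delta> (\<sigma> k))"
        and near: "\<And>k. f (\<lambda>k. snd (prod_decode (w k))) \<inter> ball (\<delta> (\<sigma> k)) ((1/2)^k * norm (\<delta> (\<sigma> k))) \<noteq> {}"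
        unfolding codes_basis_def \<delta>_def w_def by blast
      define X where "X = f (\<lambda>k. snd (prod_decode (w k)))"
      have X: "subspace X" "closed X" "\<not> contains_l1 X"
        using AC 2(2) by (auto simp: X_def UB_no_l1_def SB_def)
      have "\<exists>z. z \<in> X \<and> norm (z - \<delta> (\<sigma> k)) \<le> (1/2)^k * norm (\<delta> (\<sigma> k))" for k
        using near[of k] by (force simp: X_def dist_norm norm_minus_commute)
      then obtain z where z: "\<And>k. z k \<in> X" "\<And>k. norm (z k - \<delta> (\<sigma> k)) \<le> (1/2)^k * norm (\<delta> (\<sigma> k))"
        by metis
      have "contains_l1 X"
        by (rule perturbed_blocks_span_l1[OF X(1,2) z m(2) _ blocks]) (use m(1) in auto)
      then show False using X(3) by blast
    qed
    have nz: "\<delta> i \<noteq> 0" for i using d(1) by (simp add: \<delta>_def)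
    have "\<exists>Y\<in>UB_no_l1. \<forall>\<sigma>\<in>G. suppression_copy Y (\<lambda>k. \<delta> (\<sigma> k))"
      by (rule tree_amalgam[OF G(1) \<open>G \<noteq> {}\<close> nz]) (rule P)
    then obtain Y where Y: "Y \<in> UB_no_l1" and emb: "\<forall>\<sigma>\<in>G. suppression_copy Y (\<lambda>k. \<delta> (\<sigma> k))"
      by blast
    have "contains_copy Y X" if XA: "X \<in> A" for X
    proof -
      obtain \<tau> where \<tau>: "f \<tau> = X" using XA 2(2) by blast
      have XU: "X \<in> UB_no_l1" using XA AC by blast
      obtain w e M where w: "codes_basis d f w" and e: "suppression M e" "\<And>k. e k \<noteq> 0"
        and X: "X \<subseteq> closure (span (range e))"
        and ed: "\<And>F a. finite F \<Longrightarrow> norm (\<Sum>k\<in>F. a k *\<^sub>R e k) \<le> 2 * norm (\<Sum>k\<in>F. a k *\<^sub>R d (fst (prod_decode (w k))))"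
        and de: "\<And>F a. finite F \<Longrightarrow> norm (\<Sum>k\<in>F. a k *\<^sub>R d (fst (prod_decode (w k)))) \<le> 2 * norm (\<Sum>k\<in>F. a k *\<^sub>R e k)"
        by (rule basis_code_exists[of d f \<tau> X, OF d \<tau> XU]) (rule that; assumption)
      obtain \<sigma> where \<sigma>: "\<sigma> \<in> G" "w = (\<lambda>k. fst (prod_decode (\<sigma> k)))"
        using G(2) w by blast
      have dw: "d (fst (prod_decode (w k))) = \<delta> (\<sigma> k)" for k by (simp add: \<sigma>(2) \<delta>_def)
      obtain E where E: "\<And>k. E k \<in> Y"
        and low: "\<And>F a. finite F \<Longrightarrow> norm (\<Sum>k\<in>F. a k *\<^sub>R \<delta> (\<sigma> k)) \<le> norm (\<Sum>k\<in>F. a k *\<^sub>R E k)"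
        and up: "\<And>F a b. finite F \<Longrightarrow> (\<And>H. H \<subseteq> F \<Longrightarrow> norm (\<Sum>k\<in>H. a k *\<^sub>R \<delta> (\<sigma> k)) \<le> b) \<Longrightarrow>
            norm (\<Sum>k\<in>F. a k *\<^sub>R E k) \<le> b"
        using bspec[OF emb \<sigma>(1)] unfolding suppression_copy_def by blast
      show ?thesis
      proof (rule equivalent_sequences_copy[OF e X])
        show "subspace Y" "closed Y" using Y by (auto simp: UB_no_l1_def SB_def)
        show "E n \<in> Y" for n by (rule E)
        show "(0::real) < 1/2" by simp
        show "1/2 * norm (\<Sum>n\<in>F. a n *\<^sub>R e n) \<le> norm (\<Sum>n\<in>F. a n *\<^sub>R E n)" if "finite F" for F a
          using ed[OF that, of a] low[OF that, of a] by (simp add: dw)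
        \<comment> \<open>A subset sum of the branch vectors is compared with the basis at cost 2,
          and the subset is then enlarged to F at cost M.\<close>
        show "norm (\<Sum>n\<in>F. a n *\<^sub>R E n) \<le> 2 * M * norm (\<Sum>n\<in>F. a n *\<^sub>R e n)" if F: "finite F" for F a
        proof (rule up[OF F])
          fix H assume H: "H \<subseteq> F"
          have "norm (\<Sum>k\<in>H. a k *\<^sub>R \<delta> (\<sigma> k)) \<le> 2 * norm (\<Sum>k\<in>H. a k *\<^sub>R e k)"
            using de[of H a] F H finite_subset by (auto simp: dw)
          also have "\<dots> \<le> 2 * (M * norm (\<Sum>k\<in>F. a k *\<^sub>R e k))"
            using suppressionD[OF e(1) F H] by simp
          finally show "norm (\<Sum>k\<in>H. a k *\<^sub>R \<delta> (\<sigma> k)) \<le> 2 * M * norm (\<Sum>k\<in>F. a k *\<^sub>R e k)" by simp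
        qed
      qed
    qed
    then show ?thesis using Y by blast
  qed
qed

end
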